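(* Consider the nonstationary heavy-tailed multi-armed bandit problem with $K$ arms, horizon $T$ and variation budget $V_T>0$, where every reward satisfies $\mathbb{E}[(X_t^k)^2]\le1$. Let $\tau=\lceil K^{1/3}(T/V_T)^{2/3}\rceil$, let $a>1$ and $\zeta>0$ satisfy $\psi(2\zeta/a)\ge 2a/\zeta$, where $\psi(x)=(1+1/x)\ln(1+x)-1$, and let R-RMOSS be the policy that partitions $\{1,\dots,T\}$ into consecutive epochs of length $\tau$ (the last possibly shorter) and on each epoch discards all past observations and runs Robust MOSS afresh with horizon parameter $\tau$. Then \[\sup_{\mathcal{F}_T^{\mathcal{K}}\in\mathcal{E}(V_T,T,K)} R_T^{\text{R-RMOSS}}\in\mathcal{O}\big((KV_T)^{1/3}T^{2/3}\big).\]
   Context: Arms $\mathcal{K}=\{1,\dots,K\}$, times $\mathcal{T}=\{1,\dots,T\}$. For each arm $k$ and time $t$, reward $X_t^k$ is drawn from a distribution $f_t^k$ (all $X_t^k$ independent), with mean $\mu_t^k$. The environment is the collection of these distribution sequences; its total variation is $\sum_{t=1}^{T-1}\sup_k|\mu_{t+1}^k-\mu_t^k|$, and $\mathcal{E}(V_T,T,K)$ is the set of environments (satisfying $\mathbb{E}[(X_t^k)^2]\le 1$ for all $k,t$) with total variation at most $V_T$. A policy chooses $\varphi_t$ based on past observations $\{(\varphi_s,X_s^{\varphi_s})\}_{s<t}$; the regret is $R_T=\mathbb{E}[\sum_{t=1}^T(\max_k\mu_t^k-\mu_t^{\varphi_t})]$. Robust MOSS with horizon parameter $H$: let $\ln_+(x)=\max(\ln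 x,1)$, $h(m)=a^{\lfloor\log_a m\rfloor+1}$, $B_m=\sqrt{h(m)/\ln_+(H/(Kh(m)))}$, $c_m=\sqrt{\ln_+(H/(Km))/m}$, $\mathrm{sat}(x,B)=\mathrm{sign}(x)\min(|x|,B)$. It first selects each arm once; afterwards at time $t$, with $n_k(t)$ the number of past selections of arm $k$ (since the last restart) and $\bar\mu^k_{n_k(t)}=\frac{1}{n_k(t)}\sum_{s}\mathbf{1}\{\varphi_s=k\}\mathrm{sat}(X_s^{\varphi_s},B_{n_k(t)})$ (sum over those past times), it selects $\arg\max_k\bar\mu^k_{n_k(t)}+(1+\zeta)c_{n_k(t)}$.
   Formalization: The bound is proved, with a constant depending only on a and ζ, under the added condition V_T ≥ sqrt(K/T) (equivalently τ ≤ T); without such a lower bound on V_T it fails, since stationary environments have regret that does not vanish as V_T → 0. *)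

theory Defs
  imports "HOL-Probability.Probability"
begin

(* Arms are 1..K, times are 1..T.  An environment is f :: nat => nat => real measure,
   f t k being the reward distribution of arm k at time t. *)

definition lnp :: "real \<Rightarrow> real" where
  "lnp x = max (ln x) 1"

definition hfun :: "real \<Rightarrow> nat \<Rightarrow> real" where
  "hfun a m = a powr (real_of_int \<lfloor>log a (real m)\<rfloor> + 1)"

definition Bm :: "real \<Rightarrow> real \<Rightarrow> nat \<Rightarrow> nat \<Rightarrow> real" where
  "Bm a H K m = sqrt (hfun a m / lnp (H / (real K * hfun a m)))"

definition cm :: "real \<Rightarrow> nat \<Rightarrow> nat \<Rightarrow> real" where
  "cm H K m = sqrt (lnp (H / (real K * real m)) / real m)"

definition sat :: "real \<Rightarrow> real \<Rightarrow> real" where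
  "sat x B = sgn x * min \<bar>x\<bar> B"

definition psi :: "real \<Rightarrow> real" where
  "psi x = (1 + 1 / x) * ln (1 + x) - 1"

(* Robust MOSS decision, given the history (arm, observed reward) since the last restart,
   in chronological order.  First each arm 1..K once, then the maximal index
   (ties broken towards the smallest arm). *)
definition rmoss_choice :: "real \<Rightarrow> real \<Rightarrow> real \<Rightarrow> nat \<Rightarrow> (nat \<times> real) list \<Rightarrow> nat" where
  "rmoss_choice a \<zeta> H K hl =
    (if length hl < K then length hl + 1
     else (let n = (\<lambda>k. length (filter (\<lambda>p. fst p = k) hl));
               mu = (\<lambda>k. (\<Sum>p\<leftarrow>filter (\<lambda>p. fst p = k) hl. sat (snd p) (Bm a H K (n k)))
                         / real (n k));
               idx = (\<lambda>k. mu k + (1 + \<zeta>) * cm H K (n k))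
           in LEAST k. k \<in> {1..K} \<and> (\<forall>j\<in>{1..K}. idx j \<le> idx k)))"

(* R-RMOSS decision at time t (t >= 1) given the full history of times 1..t-1:
   epochs are {j*tau+1 .. (j+1)*tau}; observations before the current epoch are discarded
   and Robust MOSS is run with horizon parameter tau. *)
definition rrmoss_choice :: "real \<Rightarrow> real \<Rightarrow> nat \<Rightarrow> nat \<Rightarrow> nat \<Rightarrow> (nat \<times> real) list \<Rightarrow> nat" where
  "rrmoss_choice a \<zeta> \<tau> K t h = rmoss_choice a \<zeta> (real \<tau>) K (drop (((t - 1) div \<tau>) * \<tau>) h)"

fun rr_hist :: "real \<Rightarrow> real \<Rightarrow> nat \<Rightarrow> nat \<Rightarrow> (nat \<times> nat \<Rightarrow> real) \<Rightarrow> nat \<Rightarrow> (nat \<times> real) list" where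
  "rr_hist a \<zeta> \<tau> K \<omega> 0 = []"
| "rr_hist a \<zeta> \<tau> K \<omega> (Suc n) =
     (let h = rr_hist a \<zeta> \<tau> K \<omega> n; k = rrmoss_choice a \<zeta> \<tau> K (Suc n) h
      in h @ [(k, \<omega> (Suc n, k))])"

definition rr_arm :: "real \<Rightarrow> real \<Rightarrow> nat \<Rightarrow> nat \<Rightarrow> (nat \<times> nat \<Rightarrow> real) \<Rightarrow> nat \<Rightarrow> nat" where
  "rr_arm a \<zeta> \<tau> K \<omega> t = rrmoss_choice a \<zeta> \<tau> K t (rr_hist a \<zeta> \<tau> K \<omega> (t - 1))"

definition mean :: "(nat \<Rightarrow> nat \<Rightarrow> real measure) \<Rightarrow> nat \<Rightarrow> nat \<Rightarrow> real" where
  "mean f t k = (\<integral>x. x \<partial>(f t k))"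

definition env_class :: "nat \<Rightarrow> nat \<Rightarrow> real \<Rightarrow> (nat \<Rightarrow> nat \<Rightarrow> real measure) \<Rightarrow> bool" where
  "env_class K T V f \<longleftrightarrow>
     (\<forall>t\<in>{1..T}. \<forall>k\<in>{1..K}. prob_space (f t k) \<and> sets (f t k) = sets borel \<and>
        (\<integral>\<^sup>+x. ennreal (x\<^sup>2) \<partial>(f t k)) \<le> 1)
     \<and> (\<Sum>t\<in>{1..<T}. (SUP k\<in>{1..K}. \<bar>mean f (t + 1) k - mean f t k\<bar>)) \<le> V"

definition rr_tau :: "nat \<Rightarrow> nat \<Rightarrow> real \<Rightarrow> nat" where
  "rr_tau K T V = nat \<lceil>real K powr (1/3) * (real T / V) powr (2/3)\<rceil>"

(* regret of R-RMOSS; the rewards X_t^k are independent, X_t^k ~ f t k (product measure) *)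
definition rr_regret :: "real \<Rightarrow> real \<Rightarrow> nat \<Rightarrow> nat \<Rightarrow> real \<Rightarrow> (nat \<Rightarrow> nat \<Rightarrow> real measure) \<Rightarrow> real" where
  "rr_regret a \<zeta> K T V f =
     (\<integral>\<omega>. (\<Sum>t\<in>{1..T}. Max (mean f t ` {1..K}) - mean f t (rr_arm a \<zeta> (rr_tau K T V) K \<omega> t))
        \<partial>(PiM ({1..T} \<times> {1..K}) (\<lambda>(t, k). f t k)))"

end

theory Submission
  imports Defs
begin

text \<open>Write \<open>\<epsilon> = sqrt (K / \<tau>)\<close>, and consider an epoch in which every mean moves by at most \<open>v\<close>. Since the
  policy maximises the index, the regret at time \<open>t\<close> is at most \<open>2v + 2\<epsilon>\<close> plus the amount by which the
  index of the best arm undershoots its mean minus \<open>v + \<epsilon>\<close>, plus the amount by which the index of the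
  selected arm overshoots its mean plus \<open>v + \<epsilon>\<close>. Both deviations are dominated path by path by linear
  combinations of exponential supermartingales, products over time of predictable factors of
  conditional expectation at most 1, so neither a maximal inequality nor an integration of tails is
  needed. The truncation level is constant while the number of pulls stays in a geometric block
  \<open>[a^j, a^(j+1))\<close>; for the undershoot one takes one supermartingale per block, and the coefficients
  sum to \<open>O(\<epsilon>)\<close>. For the overshoot one takes one supermartingale per arm and number of pulls, and the
  coefficients of one arm sum to \<open>O(1/\<epsilon>)\<close>. An epoch thus costs \<open>O(sqrt (K \<tau>) + v \<tau>)\<close>; summing over
  the epochs and inserting \<open>\<tau>\<close> gives the claim. If \<open>K V \<ge> T\<close>, the bound \<open>2T\<close> suffices.\<close>

section \<open>Elementary inequalities\<close>

text \<open>The two deviations are charged differently. The best arm may keep the same pull count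
  for a long time, so its undershoot is paid at every time: \<open>\<tau>\<close> times
  \<open>O(\<epsilon>)\<close>. The selected arm raises its count, so each pair of arm and count is
  paid at most once: \<open>K\<close> arms at \<open>O(1/\<epsilon>)\<close>. The choice of
  \<epsilon> makes \<open>\<tau> \<epsilon> = K / \<epsilon>\<close>. Domination comes from
  \<open>z \<le> exp z\<close> at a scaled excess z. Subtracting \<epsilon> beforehand leaves a
  factor decaying in \<open>\<epsilon> * sqrt n\<close> in the coefficient, hence summability. In
  the bonus \<open>(1 + \<zeta>) * c\<close>, one unit pays the truncation bias 1/B; the rest, at
  least \<open>\<zeta> / B\<close>, lets Bennett's bound gain
  \<open>L = lnp (\<tau> / (K * h))\<close>, that is, a factor \<open>K * h / \<tau>\<close>.
  Without it the undershoot coefficients would sum to a constant, not to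
  \<open>O(\<epsilon>)\<close>.\<close>

lemma exp_le_quadratic:
  fixes x c :: real
  assumes "x \<le> c" "c > 0"
  shows "exp x \<le> 1 + x + x\<^sup>2 * ((exp c - 1 - c) / c\<^sup>2)"
\<comment> \<open>The coefficient is the value at c of the increasing function
  \<open>(exp y - 1 - y) / y^2\<close>. For negative x its lower bound 1/2 suffices; for positive x
  the power series with coefficients \<open>1 / (n + 2)!\<close> are compared termwise.\<close>
proof (cases "x \<le> 0")
  case True
  obtain t where t: "exp x = (\<Sum>m<3. x ^ m / fact m) + exp t / fact 3 * x ^ 3"
    using Maclaurin_exp_le[of x 3] by blast
  have "x ^ 3 \<le> 0" using True by (simp add: power3_eq_cube mult_nonneg_nonpos mult_nonpos_nonpos)
  hence "exp t / fact 3 * x ^ 3 \<le> 0" by (intro mult_nonneg_nonpos) auto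
  hence 1: "exp x \<le> 1 + x + x\<^sup>2 * (1/2)"
    using t by (simp add: numeral_3_eq_3 power2_eq_square)
  have "1/2 \<le> (exp c - 1 - c) / c\<^sup>2"
    using exp_lower_Taylor_quadratic[of c] assms(2) by (simp add: field_simps)
  hence "x\<^sup>2 * (1/2) \<le> x\<^sup>2 * ((exp c - 1 - c) / c\<^sup>2)"
    by (intro mult_left_mono) auto
  with 1 show ?thesis by linarith
next
  case False
  have e: "exp y = 1 + y + y\<^sup>2 * (\<Sum>n. y ^ n / fact (n + 2))" "summable (\<lambda>n. y ^ n / fact (n + 2))"
    if "y > 0" for y :: real
  proof -
    have s: "summable (\<lambda>n. y ^ n / fact n)"
      using summable_exp_generic[of y] by (simp add: divide_inverse mult.commute)
    have "summable (\<lambda>n. y ^ (n+2) / fact (n+2))"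
      using summable_ignore_initial_segment[OF s, of 2] by simp
    hence "summable (\<lambda>n. (1/y\<^sup>2) * (y ^ (n+2) / fact (n+2)))" by (rule summable_mult)
    moreover have "(1/y\<^sup>2) * (y ^ (n+2) / fact (n+2)) = y ^ n / fact (n+2)" for n
      using that by (simp only: power_add power2_eq_square) (simp del: fact_Suc)
    ultimately show s2: "summable (\<lambda>n. y ^ n / fact (n + 2))" by simp
    have "exp y = 1 + y + (\<Sum>n. y ^ (n+2) / fact (n+2))"
      using exp_first_two_terms[of y] by (simp add: divide_inverse mult.commute)
    also have "(\<lambda>n. y ^ (n+2) / fact (n+2)) = (\<lambda>n. y\<^sup>2 * (y ^ n / fact (n+2)))"
      by (auto simp: power2_eq_square)
    also have "(\<Sum>n. y\<^sup>2 * (y ^ n / fact (n+2))) = y\<^sup>2 * (\<Sum>n. y ^ n / fact (n+2))"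
      using suminf_mult[OF s2] by simp
    finally show "exp y = 1 + y + y\<^sup>2 * (\<Sum>n. y ^ n / fact (n + 2))" .
  qed
  have x: "x > 0" using False by simp
  have "(\<Sum>n. x ^ n / fact (n + 2)) \<le> (\<Sum>n. c ^ n / fact (n + 2))"
    using x assms by (intro suminf_le e divide_right_mono power_mono) auto
  also have "\<dots> = (exp c - 1 - c) / c\<^sup>2" using e(1)[of c] assms by simp
  finally have "x\<^sup>2 * (\<Sum>n. x ^ n / fact (n + 2)) \<le> x\<^sup>2 * ((exp c - 1 - c) / c\<^sup>2)"
    by (intro mult_left_mono) auto
  thus ?thesis using e(1)[OF x] by linarith
qed

text \<open>The quadratic bound at the ceiling \<open>lam * c\<close> is integrated and
  \<open>1 + G \<le> exp G\<close> is applied. Only the bound 1 on the variance enters, so one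
  constant compensator serves all times and arms.\<close>

lemma (in prob_space) bennett_mgf:
  fixes Z :: "'a \<Rightarrow> real"
  assumes [measurable]: "Z \<in> borel_measurable M"
    and bd: "\<And>x. x \<in> space M \<Longrightarrow> \<bar>Z x\<bar> \<le> c" and "c > 0" "lam > 0"
    and mean: "expectation Z = 0" and var: "expectation (\<lambda>x. (Z x)\<^sup>2) \<le> 1"
  shows "(\<integral>\<^sup>+x. ennreal (exp (lam * Z x - (exp (lam * c) - 1 - lam * c) / c\<^sup>2)) \<partial>M) \<le> 1"
proof -
  define G where "G = (exp (lam * c) - 1 - lam * c) / c\<^sup>2"
  have G0: "G \<ge> 0" unfolding G_def using exp_ge_add_one_self[of "lam * c"]
    by (intro divide_nonneg_nonneg) (auto simp: algebra_simps)
  have iZ: "integrable M Z"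
    by (rule integrable_const_bound[where B = c]) (use bd in \<open>auto intro!: AE_I2\<close>)
  have iZ2: "integrable M (\<lambda>x. (Z x)\<^sup>2)"
  proof (rule integrable_const_bound[where B = "c\<^sup>2"])
    show "AE x in M. norm ((Z x)\<^sup>2) \<le> c\<^sup>2"
      using bd \<open>c > 0\<close> by (auto intro!: AE_I2 simp: abs_le_square_iff[symmetric])
  qed auto
  have pw: "exp (lam * Z x) \<le> 1 + lam * Z x + (Z x)\<^sup>2 * G" if "x \<in> space M" for x
  proof -
    have "exp (lam * Z x) \<le> 1 + lam * Z x + (lam * Z x)\<^sup>2 * ((exp (lam * c) - 1 - lam * c) / (lam * c)\<^sup>2)"
      using bd[OF that] assms by (intro exp_le_quadratic) (auto simp: abs_le_iff)
    also have "(lam * Z x)\<^sup>2 * ((exp (lam * c) - 1 - lam * c) / (lam * c)\<^sup>2) = (Z x)\<^sup>2 * G"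
      unfolding G_def using assms by (simp add: power_mult_distrib)
    finally show ?thesis .
  qed
  have "(\<integral>\<^sup>+x. ennreal (exp (lam * Z x - G)) \<partial>M)
      \<le> (\<integral>\<^sup>+x. ennreal (exp (-G) * (1 + lam * Z x + (Z x)\<^sup>2 * G)) \<partial>M)"
    using pw by (intro nn_integral_mono ennreal_leI) (auto simp: exp_diff exp_minus field_simps)
  also have "\<dots> = ennreal (\<integral>x. exp (-G) * (1 + lam * Z x + (Z x)\<^sup>2 * G) \<partial>M)"
  proof (rule nn_integral_eq_integral)
    show "AE x in M. 0 \<le> exp (-G) * (1 + lam * Z x + (Z x)\<^sup>2 * G)"
    proof (rule AE_I2, rule mult_nonneg_nonneg)
      fix x assume "x \<in> space M"
      from pw[OF this] show "0 \<le> 1 + lam * Z x + (Z x)\<^sup>2 * G"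
        using exp_ge_zero[of "lam * Z x"] by linarith
    qed auto
  qed (use iZ iZ2 in auto)
  also have "(\<integral>x. exp (-G) * (1 + lam * Z x + (Z x)\<^sup>2 * G) \<partial>M)
      = exp (-G) * (1 + G * expectation (\<lambda>x. (Z x)\<^sup>2))"
    using iZ iZ2 mean by (simp add: prob_space mult.commute)
  also have "\<dots> \<le> exp (-G) * (1 + G)"
    using var G0 by (intro mult_left_mono) (auto simp: mult_left_le)
  also have "\<dots> \<le> exp (-G) * exp G" using exp_ge_add_one_self[of G] by (intro mult_left_mono) auto
  also have "\<dots> = 1" by (simp add: exp_minus)
  finally show ?thesis unfolding G_def by (simp add: ennreal_leI)
qed

section \<open>Saturation and the tuning functions of the policy\<close>

lemma abs_sat_le: "B \<ge> 0 \<Longrightarrow> \<bar>sat x B\<bar> \<le> B"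
  by (auto simp: sat_def abs_mult sgn_if)

lemma abs_sat_le_abs: "B \<ge> 0 \<Longrightarrow> \<bar>sat x B\<bar> \<le> \<bar>x\<bar>"
  by (auto simp: sat_def abs_mult sgn_if)

text \<open>Truncation changes x only where \<open>\<bar>x\<bar> > B\<close>, and there
  \<open>\<bar>x\<bar> \<le> x^2 / B\<close>. With second moments at most 1 the truncation bias is
  therefore at most 1/B.\<close>

lemma abs_diff_sat_le: "B > 0 \<Longrightarrow> \<bar>sat x B - x\<bar> \<le> x\<^sup>2 / B"
proof -
  assume B: "B > 0"
  have "\<bar>sat x B - x\<bar> = max 0 (\<bar>x\<bar> - B)"
    using B by (auto simp: sat_def sgn_if min_def)
  also have "\<dots> \<le> x\<^sup>2 / B"
  proof (cases "\<bar>x\<bar> \<le> B")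
    case False
    hence "B * \<bar>x\<bar> \<le> \<bar>x\<bar> * \<bar>x\<bar>" using B by (intro mult_right_mono) auto
    moreover have "(\<bar>x\<bar> - B) * B = B * \<bar>x\<bar> - B * B" by (simp add: algebra_simps)
    moreover have "\<bar>x\<bar> * \<bar>x\<bar> = x\<^sup>2" by (simp add: power2_eq_square)
    moreover have "B * B \<ge> 0" by simp
    ultimately have "(\<bar>x\<bar> - B) * B \<le> x\<^sup>2" by linarith
    thus ?thesis using False B by (simp add: field_simps)
  qed (use B in auto)
  finally show ?thesis .
qed

lemma sat_measurable [measurable]:
  fixes g b :: "'a \<Rightarrow> real"
  assumes [measurable]: "g \<in> borel_measurable M" "b \<in> borel_measurable M"
  shows "(\<lambda>x. sat (g x) (b x)) \<in> borel_measurable M"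
  unfolding sat_def by measurable

lemma lnp_ge_1: "lnp x \<ge> 1" by (simp add: lnp_def)

lemma lnp_mono: "0 < x \<Longrightarrow> x \<le> y \<Longrightarrow> lnp x \<le> lnp y"
  unfolding lnp_def by (intro max.mono) auto

lemma exp_minus_lnp: "x > 0 \<Longrightarrow> exp (- lnp x) \<le> 1 / x"
proof -
  assume "x > 0"
  have "exp (- lnp x) \<le> exp (- ln x)" by (simp add: lnp_def)
  also have "\<dots> = 1 / x" using \<open>x > 0\<close> by (simp add: exp_minus inverse_eq_divide)
  finally show ?thesis .
qed

text \<open>The third identity makes the truncation level a function of a natural block index, which
  is what permits one supermartingale per block.\<close>

lemma hfun_bounds:
  assumes "a > 1" "m \<ge> 1"
  shows "real m \<le> hfun a m" "hfun a m \<le> a * real m" "hfun a m = a ^ Suc (nat \<lfloor>log a (real m)\<rfloor>)"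
proof -
  have fl: "real_of_int \<lfloor>log a (real m)\<rfloor> \<le> log a (real m)" "log a (real m) \<le> real_of_int \<lfloor>log a (real m)\<rfloor> + 1"
    by linarith+
  have m: "a powr (log a (real m)) = real m" using assms by simp
  have "a powr (log a (real m)) \<le> a powr (real_of_int \<lfloor>log a (real m)\<rfloor> + 1)"
    using fl assms by (intro powr_mono) auto
  thus "real m \<le> hfun a m" unfolding hfun_def using m by simp
  have "a powr (real_of_int \<lfloor>log a (real m)\<rfloor> + 1) \<le> a powr (log a (real m) + 1)"
    using fl assms by (intro powr_mono) auto
  also have "\<dots> = a * real m" using assms m by (simp add: powr_add)
  finally show "hfun a m \<le> a * real m" unfolding hfun_def .
  have "0 \<le> log a (real m)" using assms by simp
  hence "real_of_int \<lfloor>log a (real m)\<rfloor> + 1 = real (Suc (nat \<lfloor>log a (real m)\<rfloor>))" by simp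
  thus "hfun a m = a ^ Suc (nat \<lfloor>log a (real m)\<rfloor>)"
    unfolding hfun_def using assms by (simp only: powr_realpow[symmetric])
qed

text \<open>The only place where the hypothesis on \<open>psi\<close> is used: with \<open>lam\<close> the optimal parameter of Bennett's
  inequality at relative deviation \<open>2\<zeta>/a\<close>, the exponent gains the full term \<open>L\<close> that yields the
  factor \<open>K h / H\<close> without loss of a logarithm.\<close>

lemma lower_exponent:
  fixes a \<zeta> h L B S y n :: real
  assumes "a > 1" "\<zeta> > 0" and psi: "psi (2 * \<zeta> / a) \<ge> 2 * a / \<zeta>"
    and "h > 0" "L > 0" and B: "B = sqrt (h / L)" and n: "h / a \<le> n" "n \<le> h"
    and S: "S \<ge> n * (\<zeta> / B + y)" and "y \<ge> 0"
    and u: "u = 2 * \<zeta> / a" and lam: "lam = ln (1 + u) / (2 * B)"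
    and G: "G = (exp (lam * (2 * B)) - 1 - lam * (2 * B)) / (2 * B)\<^sup>2"
  shows "lam * S - G * n \<ge> L + y * sqrt (h * L) / \<zeta>"
proof -
  have u0: "u > 0" using u assms by simp
  have B0: "B > 0" using B assms by simp
  have B2: "B\<^sup>2 = h / L" using B assms by simp
  define l where "l = ln (1 + u)"
  have l0: "l > 0" "l \<le> u" unfolding l_def using u0 ln_add_one_self_le_self[of u] by auto
  have lB: "lam * (2 * B) = l" using lam B0 by (simp add: l_def)
  have ex: "exp l = 1 + u" unfolding l_def using u0 by simp
  have G': "G = (u - l) / (4 * B\<^sup>2)" unfolding G lB ex by (simp add: power_mult_distrib)
  have lam0: "lam > 0" using lam l0 B0 by (simp add: l_def)
  have up: "u * psi u = (1 + u) * l - u" unfolding psi_def l_def using u0 by (simp add: field_simps)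
  have psi': "psi u \<ge> 2 * a / \<zeta>" using psi u by simp
  \<comment> \<open>Because \<open>l \<le> u\<close>, the hypothesis on \<open>psi\<close> also
    bounds l, and thereby the exponential parameter, from below. The term in y needs this; the term
    L needs \<open>u * psi u \<ge> 4\<close>.\<close>
  have "psi u \<le> l" unfolding psi_def l_def[symmetric] using u0 l0 by (simp add: field_simps)
  hence l1: "l \<ge> 2 * a / \<zeta>" using psi' by linarith
  have "u * psi u \<ge> u * (2 * a / \<zeta>)" using psi' u0 by (intro mult_left_mono) auto
  moreover have "u * (2 * a / \<zeta>) = 4" using u assms by simp
  ultimately have up4: "(1 + u) * l - u \<ge> 4" using up by simp
  have "h / a * (\<zeta> / B + y) \<le> n * (\<zeta> / B + y)"
    using n assms B0 by (intro mult_right_mono) auto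
  hence "lam * S \<ge> lam * (h / a * (\<zeta> / B + y))" using S lam0 by (intro mult_left_mono) auto
  moreover have "G * n \<le> G * h" using n l0 G' by (intro mult_left_mono) auto
  \<comment> \<open>With \<zeta> written as \<open>u * a / 2\<close>, the part free of y is
    \<open>h / (2 * B)^2\<close> times \<open>u * psi u\<close>. The lower bound 4 cancels the 4 of
    the squared range, leaving \<open>h / B^2 = L\<close>.\<close>
  moreover have "lam * (h / a * (\<zeta> / B + y)) - G * h = h / (4 * B\<^sup>2) * ((1 + u) * l - u) + l * h * y / (2 * a * B)"
  proof -
    have z: "\<zeta> = u * a / 2" using u assms by simp
    have lam': "lam = l / (2 * B)" using lam l_def by simp
    show ?thesis unfolding G' z lam' using B0 \<open>a > 1\<close> by (simp add: field_simps power2_eq_square)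
  qed
  moreover have "h / (4 * B\<^sup>2) * ((1 + u) * l - u) \<ge> h / (4 * B\<^sup>2) * 4"
    using up4 assms by (intro mult_left_mono) auto
  moreover have "h / (4 * B\<^sup>2) * 4 = L" unfolding B2 using assms by simp
  moreover have "l * h * y / (2 * a * B) \<ge> y * sqrt (h * L) / \<zeta>"
  proof -
    have hB: "h / B = sqrt (h * L)"
    proof -
      have "(h / B)\<^sup>2 = h * L" unfolding power_divide B2 using assms by (simp add: power2_eq_square)
      thus ?thesis using B0 assms by (intro real_sqrt_unique[symmetric]) auto
    qed
    have "y * sqrt (h * L) / \<zeta> = (2 * a / \<zeta>) * (y * (h / B) / (2 * a))"
      using hB assms by simp
    also have "\<dots> \<le> l * (y * (h / B) / (2 * a))" using l1 assms B0 by (intro mult_right_mono) auto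
    also have "\<dots> = l * h * y / (2 * a * B)" by (simp add: mult_ac)
    finally show ?thesis .
  qed
  ultimately show ?thesis by linarith
qed

section \<open>Sums of the coefficients and of the exploration bonuses\<close>

lemma geometric_sqrt_exp_sum:
  fixes r b :: real
  assumes "r > 1" "b > 0"
  shows "(\<Sum>j<J. r ^ Suc j * exp (- b * r ^ Suc j)) \<le> 1 / (b * (1 - 1 / r))"
proof -
  have "r ^ Suc j * exp (- b * r ^ Suc j) \<le> (exp (- b * r ^ j) - exp (- b * r ^ Suc j)) / (b * (1 - 1/r))" for j
  proof -
    define y where "y = r ^ Suc j"
    have y0: "r ^ j = y / r" using assms by (simp add: y_def)
    \<comment> \<open>A comparison with an integral: \<open>(y - y / r) * exp (- b * y)\<close> is
      at most the integral of \<open>exp (- b * s)\<close> over \<open>[y / r, y]\<close>, and these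
      integrals telescope.\<close>
    have "1 + (b * y - b * y / r) \<le> exp (b * y - b * y / r)" by (rule exp_ge_add_one_self)
    hence "(1 + (b * y - b * y / r)) * exp (- b * y) \<le> exp (b * y - b * y / r) * exp (- b * y)"
      by (intro mult_right_mono) auto
    also have "\<dots> = exp (- b * y / r)" by (simp add: exp_add[symmetric])
    finally have "(b * (1 - 1/r)) * (y * exp (- b * y)) \<le> exp (- b * (y / r)) - exp (- b * y)"
      by (simp add: algebra_simps)
    moreover have "b * (1 - 1/r) > 0" using assms by simp
    ultimately show ?thesis unfolding y0 y_def[symmetric]
      by (subst pos_le_divide_eq) (auto simp: mult.commute)
  qed
  hence "(\<Sum>j<J. r ^ Suc j * exp (- b * r ^ Suc j))
      \<le> (\<Sum>j<J. (exp (- b * r ^ j) - exp (- b * r ^ Suc j)) / (b * (1 - 1/r)))"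
    by (rule sum_mono)
  also have "\<dots> = (\<Sum>j<J. exp (- b * r ^ j) - exp (- b * r ^ Suc j)) / (b * (1 - 1/r))"
    by (rule sum_divide_distrib[symmetric])
  also have "\<dots> = (exp (- b) - exp (- b * r ^ J)) / (b * (1 - 1/r))"
    by (subst sum_lessThan_telescope') simp
  also have "\<dots> \<le> 1 / (b * (1 - 1/r))"
  proof -
    have "exp (- b) \<le> 1" using assms by simp
    moreover have "exp (- b * r ^ J) \<ge> 0" by simp
    ultimately have "exp (- b) - exp (- b * r ^ J) \<le> 1" by linarith
    thus ?thesis using assms by (intro divide_right_mono) auto
  qed
  finally show ?thesis .
qed

lemma sqrt_diff_ge: "n \<ge> 1 \<Longrightarrow> 1 / (2 * sqrt (real n)) \<le> sqrt (real n) - sqrt (real (n - 1))"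
proof -
  assume n: "n \<ge> 1"
  have "sqrt (real n) * sqrt (real (n - 1)) = sqrt (real n * real (n - 1))" by (simp add: real_sqrt_mult)
  also have "\<dots> \<le> real n - 1/2"
    using n by (intro real_le_lsqrt) (auto simp: of_nat_diff power2_eq_square algebra_simps)
  finally have "sqrt (real n) * sqrt (real (n - 1)) \<le> real n - 1/2" .
  moreover have "sqrt (real n) * sqrt (real n) = real n" by simp
  ultimately have "1/2 \<le> sqrt (real n) * (sqrt (real n) - sqrt (real (n - 1)))"
    by (simp only: right_diff_distrib)
  thus ?thesis using n by (subst pos_divide_le_eq) (auto simp: mult_ac)
qed

text \<open>Each term is at most \<open>2 / b\<close> times the drop of
  \<open>exp (- b * sqrt s)\<close> from \<open>n - 1\<close> to n, so the sum telescopes.\<close>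

lemma sum_sqrt_exp:
  fixes b :: real
  assumes "b > 0"
  shows "(\<Sum>n=1..N. exp (- b * sqrt (real n)) / sqrt (real n)) \<le> 2 / b"
proof -
  have *: "exp (- b * sqrt (real n)) / sqrt (real n) \<le> (2 / b) * (exp (- b * sqrt (real (n - 1))) - exp (- b * sqrt (real n)))"
    if n: "n \<ge> 1" for n
  proof -
    have "b * (1 / (2 * sqrt (real n))) \<le> b * (sqrt (real n) - sqrt (real (n - 1)))"
      using sqrt_diff_ge[OF n] assms by (intro mult_left_mono) auto
    also have "\<dots> \<le> exp (b * (sqrt (real n) - sqrt (real (n - 1)))) - 1"
      using exp_ge_add_one_self[of "b * (sqrt (real n) - sqrt (real (n - 1)))"] by linarith
    finally have "b * (1 / (2 * sqrt (real n))) * exp (- b * sqrt (real n))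
       \<le> (exp (b * (sqrt (real n) - sqrt (real (n - 1)))) - 1) * exp (- b * sqrt (real n))"
      by (intro mult_right_mono) auto
    also have "\<dots> = exp (- b * sqrt (real (n - 1))) - exp (- b * sqrt (real n))"
      by (simp add: left_diff_distrib exp_add[symmetric] algebra_simps)
    finally have "(2 / b) * (b * (1 / (2 * sqrt (real n))) * exp (- b * sqrt (real n)))
      \<le> (2 / b) * (exp (- b * sqrt (real (n - 1))) - exp (- b * sqrt (real n)))"
      using assms by (intro mult_left_mono) auto
    thus ?thesis using assms by simp
  qed
  have "(\<Sum>n=1..N. exp (- b * sqrt (real n)) / sqrt (real n))
     \<le> (\<Sum>n=1..N. (2 / b) * (exp (- b * sqrt (real (n - 1))) - exp (- b * sqrt (real n))))"
    using * by (intro sum_mono) auto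
  also have "\<dots> = (2 / b) * (\<Sum>n=1..N. exp (- b * sqrt (real (n - 1))) - exp (- b * sqrt (real n)))"
    by (simp add: sum_distrib_left)
  also have "(\<Sum>n=1..N. exp (- b * sqrt (real (n - 1))) - exp (- b * sqrt (real n))) = 1 - exp (- b * sqrt (real N))"
    by (induction N) auto
  also have "(2 / b) * (1 - exp (- b * sqrt (real N))) \<le> (2 / b) * 1"
    using assms by (intro mult_left_mono) auto
  finally show ?thesis by simp
qed

text \<open>A discrete form of the derivative of the fourth root; it makes sums of
  \<open>n powr (-3/4)\<close> telescope.\<close>

lemma quartic_root_diff_ge:
  assumes "n \<ge> 1"
  shows "1 / sqrt (sqrt (real n)) ^ 3 \<le> 4 * (sqrt (sqrt (real n)) - sqrt (sqrt (real (n - 1))))"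
proof -
  define q p where "q = sqrt (sqrt (real n))" and "p = sqrt (sqrt (real (n - 1)))"
  have pq: "0 \<le> p" "p \<le> q" "q > 0" using assms by (auto simp: p_def q_def)
  have 4: "sqrt (sqrt x) ^ 4 = x" if "x \<ge> 0" for x
  proof -
    have "sqrt (sqrt x) ^ 4 = (sqrt (sqrt x) ^ 2) ^ 2" by (simp only: power_mult[symmetric]) simp
    also have "\<dots> = x" using that by simp
    finally show ?thesis .
  qed
  have "q ^ 4 = real n" "p ^ 4 = real (n - 1)"
    unfolding p_def q_def by (simp_all add: 4)
  hence "1 = q ^ 4 - p ^ 4" using assms by (simp add: of_nat_diff)
  also have "\<dots> = (q - p) * ((q + p) * (q\<^sup>2 + p\<^sup>2))"
    by (simp add: power2_eq_square power4_eq_xxxx algebra_simps)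
  also have "\<dots> \<le> (q - p) * ((q + q) * (q\<^sup>2 + q\<^sup>2))"
    using pq by (intro mult_left_mono mult_mono add_mono power_mono) auto
  also have "\<dots> = 4 * (q - p) * q ^ 3"
    by (simp add: power2_eq_square power3_eq_cube algebra_simps)
  finally show ?thesis using pq unfolding q_def[symmetric] p_def[symmetric]
    by (subst pos_divide_le_eq) auto
qed

text \<open>Trades the logarithm for a square root: the bonus is then at most a sum of
  \<open>n powr (-1/2)\<close> and a multiple of \<open>n powr (-3/4)\<close>, with elementary
  partial sums of the right order.\<close>

lemma lnp_le: "y > 0 \<Longrightarrow> lnp y \<le> 1 + sqrt y"
proof -
  assume y: "y > 0"
  have "ln y = 2 * ln (sqrt y)" using y by (simp add: ln_sqrt)
  also have "ln (sqrt y) = ln (sqrt y / 2) + ln 2" using y by (subst ln_div) auto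
  also have "\<dots> \<le> (sqrt y / 2 - 1) + 1"
    using y ln_le_minus_one[of "sqrt y / 2"] ln_2_less_1 by (intro add_mono) auto
  finally have "ln y \<le> sqrt y" by simp
  thus ?thesis using y by (auto simp: lnp_def intro: order.trans)
qed

text \<open>Terms vanish beyond \<open>M\<close>, about
  \<open>4 * \<kappa>^2 / \<epsilon>^2\<close>, where \<open>\<kappa> / sqrt n\<close> drops to
  \<open>\<epsilon> / 2\<close>. Up to \<open>M\<close> the partial sums are of order
  \<open>sqrt M\<close> and \<open>M powr (1/4) / sqrt \<epsilon>\<close>, both
  \<open>O(1 / \<epsilon>)\<close> for fixed \<kappa>.\<close>

lemma sum_cm_excess:
  fixes H \<kappa> :: real
  assumes "H > 0" "K \<ge> 1" "\<kappa> \<ge> 2" and e: "\<epsilon> = sqrt (real K / H)"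
  shows "(\<Sum>n=1..N. max 0 (\<kappa> * cm H K n - \<epsilon> / 2)) \<le> 8 * \<kappa>\<^sup>2 / \<epsilon>"
proof -
  define q where "q n = sqrt (sqrt (real n))" for n
  define M where "M = nat \<lfloor>4 * \<kappa>\<^sup>2 / \<epsilon>\<^sup>2\<rfloor>"
  have e0: "\<epsilon> > 0" using assms by simp
  have e2: "\<epsilon>\<^sup>2 = real K / H" using assms by simp
  have y: "H / (real K * real n) = 1 / (\<epsilon>\<^sup>2 * real n)" for n
    unfolding e2 using assms by simp
  have q: "q n > 0" "(q n)\<^sup>2 = sqrt (real n)" if "n \<ge> 1" for n using that by (auto simp: q_def)
  have c: "cm H K n \<le> 1 / sqrt (real n) + 1 / (sqrt \<epsilon> * q n ^ 3)" if n: "n \<ge> 1" for n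
  proof -
    have y0: "1 / (\<epsilon>\<^sup>2 * real n) > 0" using e0 n by simp
    have "sqrt (lnp (1 / (\<epsilon>\<^sup>2 * real n))) \<le> sqrt (1 + sqrt (1 / (\<epsilon>\<^sup>2 * real n)))"
      using lnp_le[OF y0] by simp
    also have "\<dots> \<le> sqrt 1 + sqrt (sqrt (1 / (\<epsilon>\<^sup>2 * real n)))"
      using y0 by (intro sqrt_add_le_add_sqrt) auto
    also have "sqrt (sqrt (1 / (\<epsilon>\<^sup>2 * real n))) = 1 / (sqrt \<epsilon> * q n)"
      using e0 by (simp add: real_sqrt_divide real_sqrt_mult q_def)
    finally have "sqrt (lnp (1 / (\<epsilon>\<^sup>2 * real n))) \<le> 1 + 1 / (sqrt \<epsilon> * q n)" by simp
    hence "sqrt (lnp (1 / (\<epsilon>\<^sup>2 * real n))) / sqrt (real n) \<le> (1 + 1 / (sqrt \<epsilon> * q n)) / sqrt (real n)"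
      by (rule divide_right_mono) auto
    also have "\<dots> = 1 / sqrt (real n) + 1 / (sqrt \<epsilon> * (q n * sqrt (real n)))"
      by (simp add: add_divide_distrib)
    also have "q n * sqrt (real n) = q n ^ 3" using q(2)[OF n] by (simp add: power3_eq_cube power2_eq_square)
    finally show ?thesis unfolding cm_def y real_sqrt_divide .
  qed
  have van: "max 0 (\<kappa> * cm H K n - \<epsilon> / 2) = 0" if n: "n \<ge> 1" "n \<notin> {1..M}" for n
  proof -
    have "M < n" using n by auto
    hence "real n \<ge> 4 * \<kappa>\<^sup>2 / \<epsilon>\<^sup>2" unfolding M_def by linarith
    hence n4: "4 * \<kappa>\<^sup>2 \<le> \<epsilon>\<^sup>2 * real n" using e0 by (simp add: field_simps)
    \<comment> \<open>The bound on \<kappa> puts such n in the range where the clipped logarithm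
      equals 1, so the bonus is exactly \<open>1 / sqrt n\<close>.\<close>
    have "4 * 1 \<le> 4 * \<kappa>\<^sup>2" using assms by (intro mult_left_mono) auto
    hence "1 \<le> \<epsilon>\<^sup>2 * real n" using n4 by linarith
    hence "ln (1 / (\<epsilon>\<^sup>2 * real n)) \<le> 0" by simp
    hence "lnp (1 / (\<epsilon>\<^sup>2 * real n)) = 1" by (simp add: lnp_def)
    hence cc: "cm H K n = 1 / sqrt (real n)" unfolding cm_def y by (simp add: real_sqrt_divide)
    have "sqrt (4 * \<kappa>\<^sup>2) \<le> sqrt (\<epsilon>\<^sup>2 * real n)" using n4 by simp
    hence "2 * \<kappa> \<le> \<epsilon> * sqrt (real n)" using assms(3) e0 by (simp only: real_sqrt_mult real_sqrt_abs) auto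
    hence "\<kappa> * cm H K n \<le> \<epsilon> / 2" unfolding cc using n by (simp add: field_simps)
    thus ?thesis by simp
  qed
  have "(\<Sum>n=1..N. max 0 (\<kappa> * cm H K n - \<epsilon> / 2)) \<le> (\<Sum>n\<in>{1..M} \<union> {1..N}. max 0 (\<kappa> * cm H K n - \<epsilon> / 2))"
    by (intro sum_mono2) auto
  also have "\<dots> = (\<Sum>n=1..M. max 0 (\<kappa> * cm H K n - \<epsilon> / 2))"
    using van by (intro sum.mono_neutral_right) auto
  also have "\<dots> \<le> (\<Sum>n=1..M. \<kappa> * (2 * (sqrt (real n) - sqrt (real (n - 1))) + 4 / sqrt \<epsilon> * (q n - q (n - 1))))"
  proof (intro sum_mono)
    fix n assume "n \<in> {1..M}"
    hence n: "n \<ge> 1" by simp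
    have 1: "1 / sqrt (real n) \<le> 2 * (sqrt (real n) - sqrt (real (n - 1)))"
      using sqrt_diff_ge[OF n] by simp
    have "1 / sqrt \<epsilon> * (1 / q n ^ 3) \<le> 1 / sqrt \<epsilon> * (4 * (q n - q (n - 1)))"
      using quartic_root_diff_ge[OF n] e0 unfolding q_def by (intro mult_left_mono) auto
    hence "cm H K n \<le> 2 * (sqrt (real n) - sqrt (real (n - 1))) + 4 / sqrt \<epsilon> * (q n - q (n - 1))"
      using c[OF n] 1 by simp
    hence *: "\<kappa> * cm H K n \<le> \<kappa> * (2 * (sqrt (real n) - sqrt (real (n - 1))) + 4 / sqrt \<epsilon> * (q n - q (n - 1)))"
      using assms by (intro mult_left_mono) auto
    have "0 \<le> cm H K n" using lnp_ge_1 by (simp add: cm_def lnp_def)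
    hence "0 \<le> \<kappa> * cm H K n" using assms by simp
    with * e0 show "max 0 (\<kappa> * cm H K n - \<epsilon> / 2) \<le> \<kappa> * (2 * (sqrt (real n) - sqrt (real (n - 1))) + 4 / sqrt \<epsilon> * (q n - q (n - 1)))"
      by linarith
  qed
  also have "\<dots> = \<kappa> * (2 * sqrt (real M) + 4 / sqrt \<epsilon> * q M)"
    by (induction M) (auto simp: algebra_simps q_def)
  also have "\<dots> \<le> \<kappa> * (2 * (2 * \<kappa> / \<epsilon>) + 4 / sqrt \<epsilon> * (\<kappa> / sqrt \<epsilon>))"
  proof -
    have "real M \<le> (2 * \<kappa> / \<epsilon>)\<^sup>2" unfolding M_def by (simp add: power_mult_distrib power_divide)
    hence s: "sqrt (real M) \<le> 2 * \<kappa> / \<epsilon>" using assms e0 by (intro real_le_lsqrt) auto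
    have "q M \<le> sqrt (2 * \<kappa> / \<epsilon>)" unfolding q_def using s by simp
    also have "\<dots> \<le> sqrt (\<kappa>\<^sup>2 / \<epsilon>)"
      using assms e0 by (intro real_sqrt_le_mono divide_right_mono) (auto simp: power2_eq_square)
    also have "\<dots> = \<kappa> / sqrt \<epsilon>" using assms(3) by (simp only: real_sqrt_divide real_sqrt_abs)
    finally have "q M \<le> \<kappa> / sqrt \<epsilon>" .
    with s show ?thesis using assms e0 by (intro mult_left_mono add_mono) auto
  qed
  also have "\<dots> = 8 * \<kappa>\<^sup>2 / \<epsilon>" using e0 by (simp add: power2_eq_square field_simps)
  finally show ?thesis .
qed

section \<open>Products of predictable factors\<close>

text \<open>Fubini in the coordinate i. Independence of g from that coordinate is stated as
  pointwise invariance, a form that can be read off directly from the recursion of the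
  policy.\<close>

lemma (in product_prob_space) nn_integral_independent_coordinate:
  assumes "finite I" "i \<in> I"
    and [measurable]: "g \<in> borel_measurable (Pi\<^sub>M I M)" "e \<in> borel_measurable (M i)"
    and inv: "\<And>\<omega> y. g (fun_upd \<omega> i y) = g \<omega>"
  shows "(\<integral>\<^sup>+\<omega>. g \<omega> * e (\<omega> i) \<partial>Pi\<^sub>M I M) = (\<integral>\<^sup>+\<omega>. g \<omega> \<partial>Pi\<^sub>M I M) * (\<integral>\<^sup>+y. e y \<partial>M i)"
proof -
  define J where "J = I - {i}"
  have J: "finite J" "i \<notin> J" "I = insert i J" using assms(1,2) by (auto simp: J_def)
  have Mi: "emeasure (M i) (space (M i)) = 1" using prob_space.emeasure_space_1[OF prob_space] .
  \<comment> \<open>Points of the product over \<open>J\<close> are \<open>undefined\<close> at i.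
    Filling in \<open>y0\<close> leads to the full product, where g is measurable, and by
    \<open>inv\<close> does not change g.\<close>
  obtain y0 where y0: "y0 \<in> space (M i)" using prob_space.not_empty[OF prob_space, of i] by blast
  have upd: "(\<lambda>x. x(i := y)) \<in> Pi\<^sub>M J M \<rightarrow>\<^sub>M Pi\<^sub>M I M" if "y \<in> space (M i)" for y
    unfolding J(3) using that by (intro measurable_fun_upd[where J = J]) auto
  have "(\<lambda>x. g (x(i := y0))) \<in> borel_measurable (Pi\<^sub>M J M)"
    using measurable_compose[OF upd[OF y0], of g] by simp
  hence [measurable]: "g \<in> borel_measurable (Pi\<^sub>M J M)" by (simp add: inv)
  have [measurable]: "g \<in> borel_measurable (Pi\<^sub>M (insert i J) M)" using assms(3) J(3) by simp
  have "(\<integral>\<^sup>+\<omega>. g \<omega> * e (\<omega> i) \<partial>Pi\<^sub>M I M) = (\<integral>\<^sup>+y. (\<integral>\<^sup>+x. g x * e y \<partial>Pi\<^sub>M J M) \<partial>M i)"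
    unfolding J(3) by (subst product_nn_integral_insert_rev[OF J(1,2)]) (auto simp: inv)
  also have "\<dots> = (\<integral>\<^sup>+y. (\<integral>\<^sup>+x. g x \<partial>Pi\<^sub>M J M) * e y \<partial>M i)"
    by (simp add: nn_integral_multc)
  also have "\<dots> = (\<integral>\<^sup>+x. g x \<partial>Pi\<^sub>M J M) * (\<integral>\<^sup>+y. e y \<partial>M i)"
    by (simp add: nn_integral_cmult)
  also have "(\<integral>\<^sup>+x. g x \<partial>Pi\<^sub>M J M) = (\<integral>\<^sup>+\<omega>. g \<omega> \<partial>Pi\<^sub>M I M)"
    unfolding J(3) by (subst product_nn_integral_insert_rev[OF J(1,2)]) (auto simp: inv Mi)
  finally show ?thesis .
qed

text \<open>The hypothesis \<open>inv\<close> is predictability: the switch \<open>A s\<close>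
  ignores its own coordinate and all later ones. The last factor thus reads a coordinate that is
  fresh for everything else, and it integrates out to at most 1 where it is switched on; the rest is
  induction.\<close>

lemma (in product_prob_space) nn_integral_predictable_prod_le_1:
  fixes A :: "nat \<Rightarrow> ('i \<Rightarrow> 'a) \<Rightarrow> bool"
  assumes "finite I" "inj \<iota>"
    and "\<And>s. m \<le> s \<Longrightarrow> s < n \<Longrightarrow> \<iota> s \<in> I"
    and "\<And>s. m \<le> s \<Longrightarrow> s < n \<Longrightarrow> Measurable.pred (Pi\<^sub>M I M) (A s)"
    and "\<And>s. m \<le> s \<Longrightarrow> s < n \<Longrightarrow> e s \<in> borel_measurable (M (\<iota> s))"
    and "\<And>s. m \<le> s \<Longrightarrow> s < n \<Longrightarrow> (\<integral>\<^sup>+x. e s x \<partial>M (\<iota> s)) \<le> 1"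
    and inv: "\<And>r s \<omega> y. r \<le> s \<Longrightarrow> A r (fun_upd \<omega> (\<iota> s) y) = A r \<omega>"
  shows "(\<integral>\<^sup>+\<omega>. (\<Prod>s\<in>{m..<n}. if A s \<omega> then e s (\<omega> (\<iota> s)) else 1) \<partial>Pi\<^sub>M I M) \<le> (1 :: ennreal)"
  using assms(3-6)
proof (induction n)
  case 0
  interpret P: prob_space "Pi\<^sub>M I M" by (intro prob_space_PiM prob_space)
  show ?case by (simp add: P.emeasure_space_1)
next
  case (Suc n)
  interpret P: prob_space "Pi\<^sub>M I M" by (intro prob_space_PiM prob_space)
  have IH: "(\<integral>\<^sup>+\<omega>. (\<Prod>s\<in>{m..<n}. if A s \<omega> then e s (\<omega> (\<iota> s)) else 1) \<partial>Pi\<^sub>M I M) \<le> 1"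
    using Suc.prems by (intro Suc.IH) auto
  show ?case
  proof (cases "m \<le> n")
    case False
    thus ?thesis by (simp add: P.emeasure_space_1)
  next
    case True
    define g where "g \<omega> = (\<Prod>s\<in>{m..<n}. if A s \<omega> then e s (\<omega> (\<iota> s)) else 1)" for \<omega>
    note [measurable] = Suc.prems(2)[OF True lessI] Suc.prems(3)[OF True lessI]
    have ms: "(\<lambda>\<omega>. e s (\<omega> (\<iota> s))) \<in> borel_measurable (Pi\<^sub>M I M)" if "m \<le> s" "s < Suc n" for s
      using Suc.prems(1,3)[OF that] by (intro measurable_compose[OF measurable_component_singleton])
    have [measurable]: "g \<in> borel_measurable (Pi\<^sub>M I M)"
      unfolding g_def using Suc.prems(2) ms by (intro borel_measurable_prod_ennreal measurable_If) auto
    have ginv: "g (fun_upd \<omega> (\<iota> n) y) = g \<omega>" for \<omega> y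
      unfolding g_def using inv injD[OF assms(2)] by (intro prod.cong) (auto dest: injD[OF assms(2)])
    have "(\<integral>\<^sup>+\<omega>. (\<Prod>s\<in>{m..<Suc n}. if A s \<omega> then e s (\<omega> (\<iota> s)) else 1) \<partial>Pi\<^sub>M I M)
        = (\<integral>\<^sup>+\<omega>. (if A n \<omega> then 0 else g \<omega>) + (if A n \<omega> then g \<omega> else 0) * e n (\<omega> (\<iota> n)) \<partial>Pi\<^sub>M I M)"
      using True by (intro nn_integral_cong) (simp add: g_def prod.atLeastLessThan_Suc)
    also have "\<dots> = (\<integral>\<^sup>+\<omega>. (if A n \<omega> then 0 else g \<omega>) \<partial>Pi\<^sub>M I M)
        + (\<integral>\<^sup>+\<omega>. (if A n \<omega> then g \<omega> else 0) * e n (\<omega> (\<iota> n)) \<partial>Pi\<^sub>M I M)"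
      using ms[OF True lessI] by (intro nn_integral_add) auto
    also have "(\<integral>\<^sup>+\<omega>. (if A n \<omega> then g \<omega> else 0) * e n (\<omega> (\<iota> n)) \<partial>Pi\<^sub>M I M)
        = (\<integral>\<^sup>+\<omega>. (if A n \<omega> then g \<omega> else 0) \<partial>Pi\<^sub>M I M) * (\<integral>\<^sup>+y. e n y \<partial>M (\<iota> n))"
      using True Suc.prems(1) assms(1) by (intro nn_integral_independent_coordinate) (auto simp: inv ginv)
    also have "\<dots> \<le> (\<integral>\<^sup>+\<omega>. (if A n \<omega> then g \<omega> else 0) \<partial>Pi\<^sub>M I M) * 1"
      using True Suc.prems(4) by (intro mult_left_mono) auto
    also have "(\<integral>\<^sup>+\<omega>. (if A n \<omega> then 0 else g \<omega>) \<partial>Pi\<^sub>M I M) + (\<integral>\<^sup>+\<omega>. (if A n \<omega> then g \<omega> else 0) \<partial>Pi\<^sub>M I M) * 1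
        = (\<integral>\<^sup>+\<omega>. (if A n \<omega> then 0 else g \<omega>) + (if A n \<omega> then g \<omega> else 0) \<partial>Pi\<^sub>M I M)"
      unfolding mult_1_right by (intro nn_integral_add[symmetric]) auto
    also have "\<dots> = (\<integral>\<^sup>+\<omega>. g \<omega> \<partial>Pi\<^sub>M I M)" by (intro nn_integral_cong) auto
    also have "\<dots> \<le> 1" using IH by (simp add: g_def)
    finally show ?thesis by (simp add: add_left_mono)
  qed
qed

section \<open>The policy on one epoch\<close>

lemma rr_hist_eq:
  "rr_hist a \<zeta> \<tau> K \<omega> n = map (\<lambda>s. (rr_arm a \<zeta> \<tau> K \<omega> s, \<omega> (s, rr_arm a \<zeta> \<tau> K \<omega> s))) [1..<Suc n]"
  by (induction n) (auto simp: rr_arm_def Let_def)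

lemma rr_hist_cong:
  assumes "\<And>s k. s \<le> n \<Longrightarrow> \<omega> (s, k) = \<omega>' (s, k)"
  shows "rr_hist a \<zeta> \<tau> K \<omega> n = rr_hist a \<zeta> \<tau> K \<omega>' n"
  using assms by (induction n) (auto simp: Let_def)

text \<open>The source of predictability: a decision reads only rewards of strictly earlier
  times.\<close>

lemma rr_arm_cong:
  assumes "\<And>s k. s < t \<Longrightarrow> \<omega> (s, k) = \<omega>' (s, k)"
  shows "rr_arm a \<zeta> \<tau> K \<omega> t = rr_arm a \<zeta> \<tau> K \<omega>' t"
proof (cases t)
  case (Suc n)
  have "rr_hist a \<zeta> \<tau> K \<omega> n = rr_hist a \<zeta> \<tau> K \<omega>' n"
    using assms Suc by (intro rr_hist_cong) auto
  thus ?thesis by (simp add: rr_arm_def Suc)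
qed (simp add: rr_arm_def)

lemma rmoss_choice_range:
  assumes "K \<ge> 1"
  shows "rmoss_choice a \<zeta> H K hl \<in> {1..K}"
proof -
  have *: "(LEAST k. k \<in> {1..K} \<and> (\<forall>j\<in>{1..K}. g j \<le> g k)) \<in> {1..K}" for g :: "nat \<Rightarrow> real"
  proof -
    have "Max (g ` {1..K}) \<in> g ` {1..K}" using assms by (intro Max_in) auto
    then obtain k where k: "k \<in> {1..K}" "g k = Max (g ` {1..K})" by auto
    hence "k \<in> {1..K} \<and> (\<forall>j\<in>{1..K}. g j \<le> g k)" by auto
    from LeastI[of "\<lambda>k. k \<in> {1..K} \<and> (\<forall>j\<in>{1..K}. g j \<le> g k)", OF this] show ?thesis by simp
  qed
  show ?thesis unfolding rmoss_choice_def Let_def using * by auto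
qed

lemma rr_arm_range: "K \<ge> 1 \<Longrightarrow> rr_arm a \<zeta> \<tau> K \<omega> t \<in> {1..K}"
  unfolding rr_arm_def rrmoss_choice_def by (rule rmoss_choice_range)

text \<open>The truncation bias 1/B is covered by one unit of bonus because
  \<open>hfun a n \<ge> n\<close>. The last bound gives a range free of the logarithm, used for the
  overshoot.\<close>

lemma inverse_Bm_le_cm:
  assumes "a > 1" "H > 0" "K \<ge> 1" "n \<ge> 1"
  shows "1 / Bm a H K n \<le> cm H K n" "0 < Bm a H K n" "Bm a H K n \<le> sqrt (a * real n)"
proof -
  note h = hfun_bounds[OF assms(1,4)]
  have h0: "hfun a n > 0" using h(1) assms by linarith
  have L: "lnp x \<ge> 1" "lnp x > 0" for x using lnp_ge_1[of x] by auto
  show "0 < Bm a H K n" unfolding Bm_def using h0 L by simp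
  have "1 / Bm a H K n = sqrt (lnp (H / (real K * hfun a n)) / hfun a n)"
    unfolding Bm_def by (simp add: real_sqrt_divide)
  also have "\<dots> \<le> cm H K n"
    unfolding cm_def
  proof (rule real_sqrt_le_mono, rule frac_le)
    have "H / (real K * hfun a n) \<le> H / (real K * real n)"
      using assms h h0 by (intro divide_left_mono mult_left_mono mult_pos_pos) auto
    thus "lnp (H / (real K * hfun a n)) \<le> lnp (H / (real K * real n))"
      using assms h0 by (intro lnp_mono) auto
  qed (use assms h h0 L in \<open>auto intro: less_imp_le\<close>)
  finally show "1 / Bm a H K n \<le> cm H K n" .
  have "hfun a n / lnp (H / (real K * hfun a n)) \<le> a * real n / 1"
    using h h0 L assms by (intro frac_le) auto
  thus "Bm a H K n \<le> sqrt (a * real n)" unfolding Bm_def by simp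
qed

text \<open>The condition \<open>K_tau\<close> makes the initial round over all arms fit into an
  epoch, and it keeps \<open>epsilon\<close> at most 1.\<close>

locale rrmoss =
  fixes a \<zeta> :: real and \<tau> K :: nat
  assumes a: "a > 1" and zeta: "\<zeta> > 0" and K: "K \<ge> 1" and K_tau: "K \<le> \<tau>"
begin

definition arm :: "(nat \<times> nat \<Rightarrow> real) \<Rightarrow> nat \<Rightarrow> nat" where
  "arm \<omega> t = rr_arm a \<zeta> \<tau> K \<omega> t"

definition cnt :: "(nat \<times> nat \<Rightarrow> real) \<Rightarrow> nat \<Rightarrow> nat \<Rightarrow> nat \<Rightarrow> nat" where
  "cnt \<omega> t0 t k = card {s \<in> {Suc t0..<t}. arm \<omega> s = k}"

text \<open>The level is an argument because the policy truncates its whole history in the epoch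
  anew, at the level of the current count.\<close>

definition satsum :: "(nat \<times> nat \<Rightarrow> real) \<Rightarrow> nat \<Rightarrow> nat \<Rightarrow> nat \<Rightarrow> real \<Rightarrow> real" where
  "satsum \<omega> t0 t k B = (\<Sum>s\<in>{Suc t0..<t}. if arm \<omega> s = k then sat (\<omega> (s, k)) B else 0)"

definition idx :: "(nat \<times> nat \<Rightarrow> real) \<Rightarrow> nat \<Rightarrow> nat \<Rightarrow> nat \<Rightarrow> real" where
  "idx \<omega> t0 t k = satsum \<omega> t0 t k (Bm a (real \<tau>) K (cnt \<omega> t0 t k)) / real (cnt \<omega> t0 t k)
     + (1 + \<zeta>) * cm (real \<tau>) K (cnt \<omega> t0 t k)"

lemma epoch_start:
  assumes "\<tau> dvd t0" "t0 < t" "t \<le> t0 + \<tau>"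
  shows "(t - 1) div \<tau> * \<tau> = t0"
proof -
  obtain j where j: "t0 = \<tau> * j" using assms by auto
  have tau: "\<tau> > 0" using assms by linarith
  have "t - 1 = \<tau> * j + (t - 1 - t0)" "t - 1 - t0 < \<tau>" using assms j by auto
  hence "(t - 1) div \<tau> = j" using tau by (metis add.right_neutral div_less div_mult_self4 add.commute less_not_refl)
  thus ?thesis using j by simp
qed

lemma arm_eq:
  assumes "\<tau> dvd t0" "t0 < t" "t \<le> t0 + \<tau>"
  shows "arm \<omega> t = (if t - Suc t0 < K then t - t0
    else LEAST k. k \<in> {1..K} \<and> (\<forall>j\<in>{1..K}. idx \<omega> t0 t j \<le> idx \<omega> t0 t k))"
proof -
  define hl where "hl = map (\<lambda>s. (arm \<omega> s, \<omega> (s, arm \<omega> s))) [Suc t0..<t]"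
  have "drop t0 (map (\<lambda>s. (arm \<omega> s, \<omega> (s, arm \<omega> s))) [1..<Suc (t - 1)]) = hl"
    unfolding hl_def using assms by (simp add: drop_map)
  moreover have "arm \<omega> t = rmoss_choice a \<zeta> (real \<tau>) K (drop t0 (rr_hist a \<zeta> \<tau> K \<omega> (t - 1)))"
    unfolding arm_def rr_arm_def rrmoss_choice_def epoch_start[OF assms] ..
  ultimately have hl: "arm \<omega> t = rmoss_choice a \<zeta> (real \<tau>) K hl"
    by (simp only: rr_hist_eq[of a \<zeta> \<tau> K \<omega> for \<omega>, folded arm_def])
  have len: "length hl = t - Suc t0" by (simp add: hl_def)
  have cnt: "length (filter (\<lambda>p. fst p = k) hl) = cnt \<omega> t0 t k" for k
  proof -
    have "length (filter (\<lambda>p. fst p = k) hl) = length (filter (\<lambda>s. arm \<omega> s = k) [Suc t0..<t])"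
      by (simp add: hl_def filter_map o_def)
    also have "\<dots> = card (set (filter (\<lambda>s. arm \<omega> s = k) [Suc t0..<t]))"
      by (rule distinct_card[symmetric]) simp
    also have "set (filter (\<lambda>s. arm \<omega> s = k) [Suc t0..<t]) = {s \<in> {Suc t0..<t}. arm \<omega> s = k}" by auto
    finally show ?thesis by (simp add: cnt_def)
  qed
  have sum: "(\<Sum>p\<leftarrow>filter (\<lambda>p. fst p = k) hl. sat (snd p) B) = satsum \<omega> t0 t k B" for k B
  proof -
    have "(\<Sum>p\<leftarrow>filter (\<lambda>p. fst p = k) hl. sat (snd p) B)
        = (\<Sum>s\<leftarrow>[Suc t0..<t]. if arm \<omega> s = k then sat (\<omega> (s, arm \<omega> s)) B else 0)"
      unfolding sum_list_map_filter' by (simp add: hl_def o_def cong: if_cong)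
    also have "\<dots> = satsum \<omega> t0 t k B"
      unfolding satsum_def by (simp add: interv_sum_list_conv_sum_set_nat cong: if_cong)
    finally show ?thesis .
  qed
  show ?thesis unfolding hl rmoss_choice_def Let_def cnt sum len idx_def[symmetric] using assms by auto
qed

lemma arm_init:
  assumes "\<tau> dvd t0" "t0 < t" "t \<le> t0 + K"
  shows "arm \<omega> t = t - t0"
  using arm_eq[OF assms(1,2)] assms K_tau by auto

lemma idx_le_idx_arm:
  assumes "\<tau> dvd t0" "t0 + K < t" "t \<le> t0 + \<tau>" "j \<in> {1..K}"
  shows "idx \<omega> t0 t j \<le> idx \<omega> t0 t (arm \<omega> t)"
proof -
  define P where "P k \<longleftrightarrow> k \<in> {1..K} \<and> (\<forall>j\<in>{1..K}. idx \<omega> t0 t j \<le> idx \<omega> t0 t k)" for k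
  have "Max (idx \<omega> t0 t ` {1..K}) \<in> idx \<omega> t0 t ` {1..K}" using K by (intro Max_in) auto
  then obtain k where "k \<in> {1..K}" "idx \<omega> t0 t k = Max (idx \<omega> t0 t ` {1..K})" by auto
  hence "P k" unfolding P_def by auto
  moreover have "arm \<omega> t = (LEAST k. P k)" using arm_eq[of t0 t \<omega>] assms by (auto simp: P_def)
  ultimately have "P (arm \<omega> t)" by (metis LeastI)
  thus ?thesis using assms by (auto simp: P_def)
qed

lemma arm_range: "arm \<omega> t \<in> {1..K}"
  unfolding arm_def using K by (rule rr_arm_range)

lemma arm_upd: "t \<le> s \<Longrightarrow> arm (fun_upd \<omega> (s, k) y) t = arm \<omega> t"
  unfolding arm_def by (rule rr_arm_cong) auto

lemma cnt_upd: "t \<le> s \<Longrightarrow> cnt (fun_upd \<omega> (s, k) y) t0 t k' = cnt \<omega> t0 t k'"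
  unfolding cnt_def by (intro arg_cong[where f = card]) (auto simp: arm_upd)

lemma cnt_pos:
  assumes "\<tau> dvd t0" "t0 + K < t" "k \<in> {1..K}"
  shows "cnt \<omega> t0 t k \<ge> 1"
proof -
  have "t0 + k \<in> {s \<in> {Suc t0..<t}. arm \<omega> s = k}" using assms arm_init[of t0 "t0 + k" \<omega>] by auto
  hence "card {s \<in> {Suc t0..<t}. arm \<omega> s = k} > 0" by (subst card_gt_0_iff) auto
  thus ?thesis by (simp add: cnt_def)
qed

lemma cnt_le: "cnt \<omega> t0 t k \<le> t - Suc t0"
proof -
  have "cnt \<omega> t0 t k \<le> card {Suc t0..<t}" unfolding cnt_def by (intro card_mono) auto
  thus ?thesis by simp
qed

lemma cnt_less:
  assumes "Suc t0 \<le> s" "s < t" "arm \<omega> s = k"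
  shows "cnt \<omega> t0 s k < cnt \<omega> t0 t k"
  unfolding cnt_def using assms by (intro psubset_card_mono) auto

lemma cnt_mono: "s \<le> t \<Longrightarrow> cnt \<omega> t0 s k \<le> cnt \<omega> t0 t k"
  unfolding cnt_def by (intro card_mono) auto

lemma sum_arm_const: "(\<Sum>s\<in>{Suc t0..<t}. if arm \<omega> s = k then c else 0) = real (cnt \<omega> t0 t k) * c"
  unfolding cnt_def by (simp add: sum.If_cases Int_def)

section \<open>Undershoot of the index: one supermartingale per truncation block\<close>

definition epsilon :: real where "epsilon = sqrt (real K / real \<tau>)"

text \<open>The common value of \<open>Bm\<close> at all counts n with
  \<open>\<lfloor>log a n\<rfloor> = j\<close>.\<close>

definition block_level :: "nat \<Rightarrow> real" where
  "block_level j = sqrt (a ^ Suc j / lnp (real \<tau> / (real K * a ^ Suc j)))"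

text \<open>Bennett's optimal parameter \<open>ln (1 + c * d) / c\<close> for the range
  \<open>c = 2 * B\<close> and the deviation \<open>d = \<zeta> / (a * B)\<close>: an average excess
  \<open>\<zeta> / B\<close> over at least \<open>h / a\<close> pulls, spread over h.\<close>

definition lowlam :: "nat \<Rightarrow> real" where
  "lowlam j = ln (1 + 2 * \<zeta> / a) / (2 * block_level j)"

definition lowG :: "nat \<Rightarrow> real" where
  "lowG j = (exp (lowlam j * (2 * block_level j)) - 1 - lowlam j * (2 * block_level j)) / (2 * block_level j)\<^sup>2"

text \<open>With \<open>h = a ^ Suc j\<close>: the first factor undoes the scaling in
  \<open>z \<le> exp z\<close>, the second bounds \<open>exp (- L)\<close>, and the third is the
  gain from subtracting \<open>epsilon\<close>.\<close>

definition lowcoef :: "nat \<Rightarrow> real" where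
  "lowcoef j = \<zeta> / sqrt (a ^ Suc j) * (real K * a ^ Suc j / real \<tau>) * exp (- epsilon / \<zeta> * sqrt (a ^ Suc j))"

text \<open>The parameter \<open>m\<close> stands for the means of the saturated rewards, later
  \<open>musat\<close>. It stays abstract because the pathwise bounds live in a locale without a
  measure.\<close>

definition low_prod :: "(nat \<Rightarrow> nat \<Rightarrow> real \<Rightarrow> real) \<Rightarrow> nat \<Rightarrow> nat \<Rightarrow> nat \<Rightarrow> nat \<Rightarrow> (nat \<times> nat \<Rightarrow> real) \<Rightarrow> real" where
  "low_prod m t0 t k j \<omega> = (\<Prod>s\<in>{Suc t0..<t}. if arm \<omega> s = k
     then exp (lowlam j * (m s k (block_level j) - sat (\<omega> (s, k)) (block_level j)) - lowG j) else 1)"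

lemma epsilon_pos: "epsilon > 0" using K K_tau by (simp add: epsilon_def)

lemma lowcoef_nonneg: "lowcoef j \<ge> 0" using a zeta K by (simp add: lowcoef_def)

lemma block_level_pos: "block_level j > 0"
  using a lnp_ge_1[of "real \<tau> / (real K * a ^ Suc j)"] unfolding block_level_def
  by (intro real_sqrt_gt_zero divide_pos_pos) auto

lemma lowlam_pos: "lowlam j > 0"
  using a zeta block_level_pos[of j] unfolding lowlam_def by (intro divide_pos_pos ln_gt_zero) auto

text \<open>In terms of \<open>q = sqrt (a ^ Suc j)\<close> the coefficient is
  \<open>\<zeta> * epsilon^2 * q * exp (- (epsilon / \<zeta>) * q)\<close>; along a geometric
  sequence of q these sum to \<open>epsilon^2\<close> times \<open>O(1 / epsilon)\<close>.\<close>

lemma lowcoef_sum: "(\<Sum>j<J. lowcoef j) \<le> \<zeta>\<^sup>2 / (1 - 1 / sqrt a) * epsilon"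
proof -
  have tau: "real \<tau> > 0" using K K_tau by simp
  have e2: "epsilon\<^sup>2 = real K / real \<tau>" by (simp add: epsilon_def)
  define b where "b = epsilon / \<zeta>"
  have b: "b > 0" using epsilon_pos zeta by (simp add: b_def)
  have "lowcoef j = \<zeta> * epsilon\<^sup>2 * (sqrt a ^ Suc j * exp (- b * sqrt a ^ Suc j))" for j
  proof -
    define q where "q = sqrt a ^ Suc j"
    have q: "sqrt (a ^ Suc j) = q" "q > 0" using a unfolding q_def real_sqrt_power by auto
    have "0 \<le> a ^ Suc j" using a by (intro zero_le_power) auto
    hence q2: "a ^ Suc j = q * q" unfolding q(1)[symmetric] by (simp only: real_sqrt_mult_self abs_of_nonneg)
    have "lowcoef j = \<zeta> / q * (real K * (q * q) / real \<tau>) * exp (- epsilon / \<zeta> * q)"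
      unfolding lowcoef_def q(1) unfolding q2 ..
    also have "\<dots> = \<zeta> * (real K / real \<tau>) * (q * exp (- b * q))" using q by (simp add: b_def)
    finally show ?thesis unfolding e2 q_def .
  qed
  hence "(\<Sum>j<J. lowcoef j) = \<zeta> * epsilon\<^sup>2 * (\<Sum>j<J. sqrt a ^ Suc j * exp (- b * sqrt a ^ Suc j))"
    by (simp only: sum_distrib_left)
  also have "\<dots> \<le> \<zeta> * epsilon\<^sup>2 * (1 / (b * (1 - 1 / sqrt a)))"
    using a zeta b by (intro mult_left_mono geometric_sqrt_exp_sum) auto
  also have "\<dots> = \<zeta>\<^sup>2 / (1 - 1 / sqrt a) * epsilon"
    using epsilon_pos zeta by (simp add: b_def power2_eq_square)
  finally show ?thesis .
qed

lemma low_prod_eq: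
  "low_prod m t0 t k j \<omega> = exp (lowlam j * (\<Sum>s\<in>{Suc t0..<t}. if arm \<omega> s = k
     then m s k (block_level j) - sat (\<omega> (s, k)) (block_level j) else 0) - lowG j * real (cnt \<omega> t0 t k))"
proof -
  have "low_prod m t0 t k j \<omega> = exp (\<Sum>s\<in>{Suc t0..<t}. if arm \<omega> s = k
     then lowlam j * (m s k (block_level j) - sat (\<omega> (s, k)) (block_level j)) - lowG j else 0)"
    unfolding low_prod_def by (subst exp_sum) (auto intro!: prod.cong)
  also have "(\<Sum>s\<in>{Suc t0..<t}. if arm \<omega> s = k
     then lowlam j * (m s k (block_level j) - sat (\<omega> (s, k)) (block_level j)) - lowG j else 0)
     = (\<Sum>s\<in>{Suc t0..<t}. lowlam j * (if arm \<omega> s = k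
     then m s k (block_level j) - sat (\<omega> (s, k)) (block_level j) else 0) - (if arm \<omega> s = k then lowG j else 0))"
    by (intro sum.cong) auto
  also have "\<dots> = lowlam j * (\<Sum>s\<in>{Suc t0..<t}. if arm \<omega> s = k
     then m s k (block_level j) - sat (\<omega> (s, k)) (block_level j) else 0) - lowG j * real (cnt \<omega> t0 t k)"
    by (simp only: sum_subtractf sum_distrib_left[symmetric] sum_arm_const mult.commute)
  finally show ?thesis .
qed

text \<open>Here x is a lower bound for the means of the arm over the epoch so far, and 1/B allows
  for truncation bias. The pull count is random, but at most \<open>\<tau>\<close>; the one block
  containing it does the work, and summing over all blocks removes the dependence on which one it
  is.\<close>

lemma idx_lower_bound:
  assumes t: "\<tau> dvd t0" "t0 + K < t" "t \<le> t0 + \<tau>" and k: "k \<in> {1..K}"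
    and psi: "psi (2 * \<zeta> / a) \<ge> 2 * a / \<zeta>"
    and m: "\<And>s B. s \<in> {Suc t0..<t} \<Longrightarrow> B > 0 \<Longrightarrow> m s k B \<ge> x - 1 / B"
    and J: "nat \<lfloor>log a (real \<tau>)\<rfloor> < J"
  shows "max 0 (x - epsilon - idx \<omega> t0 t k) \<le> (\<Sum>j<J. lowcoef j * low_prod m t0 t k j \<omega>)"
proof -
  have nn: "0 \<le> lowcoef j * low_prod m t0 t k j \<omega>" for j
    using lowcoef_nonneg by (simp add: low_prod_eq)
  have rhs: "0 \<le> (\<Sum>j<J. lowcoef j * low_prod m t0 t k j \<omega>)" using nn by (intro sum_nonneg) auto
  define n where "n = cnt \<omega> t0 t k"
  have n: "n \<ge> 1" unfolding n_def using cnt_pos[OF t(1,2) k] .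
  have ntau: "n \<le> \<tau>" using cnt_le[of \<omega> t0 t k] t by (simp add: n_def)
  have tau: "real \<tau> > 0" using K K_tau by simp
  define j where "j = nat \<lfloor>log a (real n)\<rfloor>"
  define h where "h = a ^ Suc j"
  define L where "L = lnp (real \<tau> / (real K * h))"
  define B where "B = block_level j"
  define y where "y = x - idx \<omega> t0 t k"
  note hb = hfun_bounds[OF a n, folded j_def]
  have h0: "h > 0" using a by (simp add: h_def)
  have BB: "Bm a (real \<tau>) K n = B" unfolding Bm_def B_def block_level_def hb(3) ..
  have B0: "B > 0" using block_level_pos by (simp add: B_def)
  have L1: "L \<ge> 1" unfolding L_def by (rule lnp_ge_1)
  have "log a (real n) \<le> log a (real \<tau>)" using a n ntau by simp
  hence "j \<le> nat \<lfloor>log a (real \<tau>)\<rfloor>" unfolding j_def by (intro nat_mono floor_mono)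
  hence jJ: "j < J" using J by simp
  show ?thesis
  proof (cases "y - epsilon \<le> 0")
    case True
    thus ?thesis using rhs by (simp add: y_def max_def)
  next
    case False
    define S where "S = (\<Sum>s\<in>{Suc t0..<t}. if arm \<omega> s = k then m s k B - sat (\<omega> (s, k)) B else 0)"
    have "S \<ge> (\<Sum>s\<in>{Suc t0..<t}. (if arm \<omega> s = k then x - 1 / B else 0) - (if arm \<omega> s = k then sat (\<omega> (s, k)) B else 0))"
      unfolding S_def using m B0 by (intro sum_mono) auto
    hence S1: "S \<ge> real n * (x - 1 / B) - satsum \<omega> t0 t k B"
      by (simp only: sum_subtractf sum_arm_const n_def satsum_def)
    have "satsum \<omega> t0 t k B = real n * (idx \<omega> t0 t k - (1 + \<zeta>) * cm (real \<tau>) K n)"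
      using n by (simp add: idx_def n_def[symmetric] BB)
    hence "S \<ge> real n * (x - 1 / B - (idx \<omega> t0 t k - (1 + \<zeta>) * cm (real \<tau>) K n))"
      using S1 by (simp only: right_diff_distrib)
    moreover have "real n * (x - 1 / B - (idx \<omega> t0 t k - (1 + \<zeta>) * cm (real \<tau>) K n)) \<ge> real n * (\<zeta> / B + y)"
    proof (rule mult_left_mono)
      \<comment> \<open>One unit of bonus pays the bias; \<open>\<zeta> / B\<close> is what remains
        for Bennett's bound.\<close>
      have "1 / B \<le> cm (real \<tau>) K n"
        using inverse_Bm_le_cm(1)[OF a tau K n] BB by simp
      hence "(1 + \<zeta>) * (1 / B) \<le> (1 + \<zeta>) * cm (real \<tau>) K n"
        using zeta by (intro mult_left_mono) auto
      moreover have "(1 + \<zeta>) * (1 / B) = 1 / B + \<zeta> / B" by (simp add: add_divide_distrib)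
      ultimately show "\<zeta> / B + y \<le> x - 1 / B - (idx \<omega> t0 t k - (1 + \<zeta>) * cm (real \<tau>) K n)"
        unfolding y_def by linarith
    qed auto
    ultimately have S: "S \<ge> real n * (\<zeta> / B + y)" by linarith
    have "lowlam j * S - lowG j * real n \<ge> L + y * sqrt (h * L) / \<zeta>"
    proof (rule lower_exponent[OF a zeta psi h0])
      show "B = sqrt (h / L)" unfolding B_def block_level_def h_def L_def ..
      show "h / a \<le> real n" "real n \<le> h" using hb a by (auto simp: h_def field_simps)
      show "lowG j = (exp (lowlam j * (2 * B)) - 1 - lowlam j * (2 * B)) / (2 * B)\<^sup>2"
        unfolding lowG_def B_def ..
      show "lowlam j = ln (1 + 2 * \<zeta> / a) / (2 * B)" unfolding lowlam_def B_def ..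
    qed (use L1 S False epsilon_pos in auto)
    moreover have "y * sqrt (h * L) / \<zeta> \<ge> y * sqrt h / \<zeta>"
      using False epsilon_pos zeta h0 L1 by (intro divide_right_mono mult_left_mono) auto
    moreover have W: "low_prod m t0 t k j \<omega> = exp (lowlam j * S - lowG j * real n)"
      unfolding low_prod_eq S_def B_def n_def ..
    ultimately have "exp (L + y * sqrt h / \<zeta>) \<le> low_prod m t0 t k j \<omega>" by simp
    hence "exp (- L) * exp (- epsilon / \<zeta> * sqrt h) * exp (L + y * sqrt h / \<zeta>)
         \<le> exp (- L) * exp (- epsilon / \<zeta> * sqrt h) * low_prod m t0 t k j \<omega>"
      by (intro mult_left_mono) auto
    also have "exp (- L) * exp (- epsilon / \<zeta> * sqrt h) * exp (L + y * sqrt h / \<zeta>) = exp ((y - epsilon) * sqrt h / \<zeta>)"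
      unfolding exp_add[symmetric] by (simp add: left_diff_distrib diff_divide_distrib)
    also have "exp (- L) * exp (- epsilon / \<zeta> * sqrt h) * low_prod m t0 t k j \<omega>
        \<le> (real K * h / real \<tau>) * exp (- epsilon / \<zeta> * sqrt h) * low_prod m t0 t k j \<omega>"
    proof (intro mult_right_mono)
      show "exp (- L) \<le> real K * h / real \<tau>"
        using exp_minus_lnp[of "real \<tau> / (real K * h)"] tau K h0 by (simp add: L_def)
    qed (auto simp: W)
    finally have "exp ((y - epsilon) * sqrt h / \<zeta>) \<le> (real K * h / real \<tau>) * exp (- epsilon / \<zeta> * sqrt h) * low_prod m t0 t k j \<omega>" .
    \<comment> \<open>This linear bound replaces the integration of a tail probability.\<close>
    moreover have "(y - epsilon) * sqrt h / \<zeta> \<le> exp ((y - epsilon) * sqrt h / \<zeta>)"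
      using exp_ge_add_one_self[of "(y - epsilon) * sqrt h / \<zeta>"] by linarith
    ultimately have "(y - epsilon) * sqrt h / \<zeta> \<le> (real K * h / real \<tau>) * exp (- epsilon / \<zeta> * sqrt h) * low_prod m t0 t k j \<omega>"
      by linarith
    hence "\<zeta> / sqrt h * ((y - epsilon) * sqrt h / \<zeta>) \<le> \<zeta> / sqrt h * ((real K * h / real \<tau>) * exp (- epsilon / \<zeta> * sqrt h) * low_prod m t0 t k j \<omega>)"
      using zeta h0 by (intro mult_left_mono) auto
    hence "y - epsilon \<le> lowcoef j * low_prod m t0 t k j \<omega>"
      using zeta h0 by (simp add: lowcoef_def h_def[symmetric] mult_ac del: power_Suc)
    also have "\<dots> \<le> (\<Sum>j<J. lowcoef j * low_prod m t0 t k j \<omega>)"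
      using nn jJ by (intro member_le_sum) auto
    finally show ?thesis using rhs by (simp add: y_def)
  qed
qed

section \<open>Overshoot of the index: one supermartingale per arm and pull count\<close>

definition up_scale :: "nat \<Rightarrow> real" where "up_scale n = 2 * sqrt (a * real n)"

text \<open>Bennett's compensator for the range \<open>up_scale n\<close>, which dominates
  \<open>2 * B\<close>, and the parameter \<open>1 / up_scale n\<close>. It equals
  \<open>(exp 1 - 2) / (4 * a * n)\<close>, so n pulls cost only a constant factor.\<close>

definition upG :: "nat \<Rightarrow> real" where
  "upG n = (exp (1 / up_scale n * up_scale n) - 1 - 1 / up_scale n * up_scale n) / (up_scale n)\<^sup>2"

text \<open>The condition \<open>cnt \<omega> t0 s k < n\<close> stops the process after the \<open>n\<close>-th pull, so that the truncation
  level can be kept at its value for \<open>n\<close> samples.\<close>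

definition up_prod :: "(nat \<Rightarrow> nat \<Rightarrow> real \<Rightarrow> real) \<Rightarrow> nat \<Rightarrow> nat \<Rightarrow> nat \<Rightarrow> nat \<Rightarrow> (nat \<times> nat \<Rightarrow> real) \<Rightarrow> real" where
  "up_prod m t0 t1 k n \<omega> = (\<Prod>s\<in>{Suc t0..<t1}. if arm \<omega> s = k \<and> cnt \<omega> t0 s k < n
     then exp (1 / up_scale n * (sat (\<omega> (s, k)) (Bm a (real \<tau>) K n) - m s k (Bm a (real \<tau>) K n)) - upG n) else 1)"

text \<open>With \<open>M = up_scale n\<close>, the prefactor is \<open>2 * M / n\<close>, where the
  2 absorbs the compensator of n pulls; the exponential is
  \<open>exp (- n * epsilon / (2 * M))\<close>, coming from half of the margin
  \<open>epsilon\<close>.\<close>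

definition upcoef :: "nat \<Rightarrow> real" where
  "upcoef n = 4 * sqrt a * (exp (- (epsilon / (4 * sqrt a)) * sqrt (real n)) / sqrt (real n))"

lemma upcoef_nonneg: "upcoef n \<ge> 0" using a by (simp add: upcoef_def)

lemma upcoef_sum: "(\<Sum>n=1..N. upcoef n) \<le> 32 * a / epsilon"
proof -
  have "(\<Sum>n=1..N. upcoef n) \<le> 4 * sqrt a * (2 / (epsilon / (4 * sqrt a)))"
    unfolding upcoef_def sum_distrib_left[symmetric]
    using a epsilon_pos by (intro mult_left_mono sum_sqrt_exp) auto
  also have "\<dots> = 32 * a / epsilon" using a by simp
  finally show ?thesis .
qed

text \<open>The margin \<open>epsilon\<close> is halved: one half is set against the random
  deviation, the other against \<open>(2 + \<zeta>) * cm\<close>, that is, the bonus plus one unit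
  for the truncation bias.\<close>

lemma idx_upper_bound:
  assumes t: "t < t1" and n: "n \<ge> 1" "cnt \<omega> t0 t k = n"
    and m: "\<And>s B. s \<in> {Suc t0..<t} \<Longrightarrow> B > 0 \<Longrightarrow> m s k B \<le> x + 1 / B"
  shows "max 0 (idx \<omega> t0 t k - x - epsilon)
    \<le> upcoef n * up_prod m t0 t1 k n \<omega> + max 0 ((2 + \<zeta>) * cm (real \<tau>) K n - epsilon / 2)"
proof -
  define B where "B = Bm a (real \<tau>) K n"
  define M where "M = up_scale n"
  have tau: "real \<tau> > 0" using K K_tau by simp
  note Bb = inverse_Bm_le_cm[OF a tau K n(1), folded B_def]
  have M0: "M > 0" using a n by (simp add: M_def up_scale_def)
  define S where "S = (\<Sum>s\<in>{Suc t0..<t}. if arm \<omega> s = k then sat (\<omega> (s, k)) B - m s k B else 0)"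
  have U: "up_prod m t0 t1 k n \<omega> = exp (S / M - upG n * real n)"
  proof -
    have "up_prod m t0 t1 k n \<omega> = (\<Prod>s\<in>{Suc t0..<t}. if arm \<omega> s = k \<and> cnt \<omega> t0 s k < n
       then exp (1 / M * (sat (\<omega> (s, k)) B - m s k B) - upG n) else 1)"
      unfolding up_prod_def B_def[symmetric] M_def[symmetric]
    \<comment> \<open>From time t on the count is at least n, so the remaining factors are 1. Hence
      one variable, taken at the end of the epoch, serves whatever random time t has count n. Before
      t every pull sees a smaller count, so the stopping condition then drops out.\<close>
    proof (rule prod.mono_neutral_right)
      show "\<forall>i\<in>{Suc t0..<t1} - {Suc t0..<t}. (if arm \<omega> i = k \<and> cnt \<omega> t0 i k < n
         then exp (1 / M * (sat (\<omega> (i, k)) B - m i k B) - upG n) else 1) = 1"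
      proof
        fix i assume "i \<in> {Suc t0..<t1} - {Suc t0..<t}"
        hence "n \<le> cnt \<omega> t0 i k" using cnt_mono[of t i \<omega> t0 k] n(2) by auto
        thus "(if arm \<omega> i = k \<and> cnt \<omega> t0 i k < n
         then exp (1 / M * (sat (\<omega> (i, k)) B - m i k B) - upG n) else 1) = 1" by simp
      qed
    qed (use t in auto)
    also have "\<dots> = (\<Prod>s\<in>{Suc t0..<t}. exp (if arm \<omega> s = k then 1 / M * (sat (\<omega> (s, k)) B - m s k B) - upG n else 0))"
      using cnt_less[of t0 _ t \<omega> k] n(2) by (intro prod.cong) auto
    also have "\<dots> = exp (\<Sum>s\<in>{Suc t0..<t}. if arm \<omega> s = k then 1 / M * (sat (\<omega> (s, k)) B - m s k B) - upG n else 0)"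
      by (rule exp_sum[symmetric]) simp
    also have "(\<Sum>s\<in>{Suc t0..<t}. if arm \<omega> s = k then 1 / M * (sat (\<omega> (s, k)) B - m s k B) - upG n else 0)
       = (\<Sum>s\<in>{Suc t0..<t}. 1 / M * (if arm \<omega> s = k then sat (\<omega> (s, k)) B - m s k B else 0) - (if arm \<omega> s = k then upG n else 0))"
      by (intro sum.cong) auto
    also have "\<dots> = 1 / M * S - upG n * real n"
      by (simp only: sum_subtractf sum_distrib_left[symmetric] sum_arm_const n(2) S_def mult.commute)
    finally show ?thesis by simp
  qed
  have "S \<ge> (\<Sum>s\<in>{Suc t0..<t}. (if arm \<omega> s = k then sat (\<omega> (s, k)) B else 0) - (if arm \<omega> s = k then x + 1 / B else 0))"
    unfolding S_def
  proof (rule sum_mono)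
    fix s assume "s \<in> {Suc t0..<t}"
    from m[OF this Bb(2)]
    show "(if arm \<omega> s = k then sat (\<omega> (s, k)) B else 0) - (if arm \<omega> s = k then x + 1 / B else 0)
      \<le> (if arm \<omega> s = k then sat (\<omega> (s, k)) B - m s k B else 0)" by simp
  qed
  hence "S \<ge> satsum \<omega> t0 t k B - real n * (x + 1 / B)"
    by (simp only: sum_subtractf sum_arm_const n(2) satsum_def)
  moreover have "satsum \<omega> t0 t k B = real n * (idx \<omega> t0 t k - (1 + \<zeta>) * cm (real \<tau>) K n)"
    using n by (simp add: idx_def B_def)
  ultimately have "real n * (idx \<omega> t0 t k - (1 + \<zeta>) * cm (real \<tau>) K n - (x + 1 / B)) \<le> S"
    by (simp only: right_diff_distrib)
  hence "idx \<omega> t0 t k - (1 + \<zeta>) * cm (real \<tau>) K n - (x + 1 / B) \<le> S / real n"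
    using n by (simp add: pos_le_divide_eq mult.commute)
  moreover have "(2 + \<zeta>) * cm (real \<tau>) K n = (1 + \<zeta>) * cm (real \<tau>) K n + cm (real \<tau>) K n"
    by (simp add: algebra_simps)
  ultimately have 1: "idx \<omega> t0 t k - x - epsilon \<le> (S / real n - epsilon / 2) + ((2 + \<zeta>) * cm (real \<tau>) K n - epsilon / 2)"
    using Bb(1) by linarith
  have 2: "S / real n - epsilon / 2 \<le> upcoef n * up_prod m t0 t1 k n \<omega>"
  proof -
    define c where "c = real n * epsilon / (2 * M)"
    have Mn: "M / real n = 2 * sqrt a / sqrt (real n)"
    proof -
      have "M / real n = 2 * sqrt a * sqrt (real n) / (sqrt (real n) * sqrt (real n))"
        by (simp add: M_def up_scale_def real_sqrt_mult)
      also have "\<dots> = 2 * sqrt a / sqrt (real n)" using n(1) by (simp del: real_sqrt_mult_self)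
      finally show ?thesis .
    qed
    have "c = epsilon / (2 * (M / real n))" by (simp add: c_def)
    hence c: "c = epsilon / (4 * sqrt a) * sqrt (real n)" unfolding Mn by simp
    have G: "exp (upG n * real n) \<le> 2"
    proof -
      have "(M)\<^sup>2 = 4 * a * real n" using a by (simp add: M_def up_scale_def power_mult_distrib)
      moreover have "1 / M * M = 1" using M0 by simp
      ultimately have "upG n * real n = (exp 1 - 2) / (4 * a)"
        using n(1) unfolding upG_def M_def[symmetric] by simp
      also have "\<dots> \<le> 1 / 4"
        using a exp_le by (simp add: field_simps)
      finally have "exp (upG n * real n) \<le> exp (1 / 4)" by simp
      also have "\<dots> \<le> 1 + 1 / 4 + (1 / 4)\<^sup>2" by (rule exp_bound) auto
      also have "\<dots> \<le> 2" by (simp add: power2_eq_square)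
      finally show ?thesis .
    qed
    have "S / real n - epsilon / 2 = M / real n * (S / M - c)"
      using M0 n by (simp add: c_def right_diff_distrib)
    also have "\<dots> \<le> M / real n * exp (S / M - c)"
    proof (rule mult_left_mono)
      show "S / M - c \<le> exp (S / M - c)" using exp_ge_add_one_self[of "S / M - c"] by linarith
    qed (use M0 in auto)
    also have "exp (S / M - c) = exp (- c) * up_prod m t0 t1 k n \<omega> * exp (upG n * real n)"
      unfolding U exp_add[symmetric] by simp
    also have "M / real n * (exp (- c) * up_prod m t0 t1 k n \<omega> * exp (upG n * real n))
        \<le> M / real n * (exp (- c) * up_prod m t0 t1 k n \<omega> * 2)"
      using G M0 by (intro mult_left_mono) (auto simp: U)
    finally have "S / real n - epsilon / 2 \<le> M / real n * (exp (- c) * up_prod m t0 t1 k n \<omega> * 2)" .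
    thus ?thesis by (simp add: Mn upcoef_def c mult_ac)
  qed
  have "upcoef n * up_prod m t0 t1 k n \<omega> \<ge> 0" using upcoef_nonneg by (simp add: U)
  with 1 2 show ?thesis by linarith
qed

text \<open>The count covers strictly earlier times only, so a later pull of the same arm sees a
  larger one. This is what allows a sum over times to be charged to distinct pairs.\<close>

lemma pull_number_inj: "inj_on (\<lambda>t. (arm \<omega> t, cnt \<omega> t0 t (arm \<omega> t))) {Suc t0..}"
proof (rule inj_onI)
  fix s t assume "s \<in> {Suc t0..}" "t \<in> {Suc t0..}"
    and *: "(arm \<omega> s, cnt \<omega> t0 s (arm \<omega> s)) = (arm \<omega> t, cnt \<omega> t0 t (arm \<omega> t))"
  thus "s = t" using cnt_less[of t0 s t \<omega>] cnt_less[of t0 t s \<omega>]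
    by (cases s t rule: linorder_cases) (auto dest: sym)
qed

end

section \<open>Expectations of the exponential products\<close>

locale reward_dist = prob_space N for N :: "real measure" +
  assumes sets_N: "sets N = sets borel"
    and second_moment: "(\<integral>\<^sup>+x. ennreal (x\<^sup>2) \<partial>N) \<le> 1"
begin

declare sets_N [measurable_cong]

lemma integrable_square: "integrable N (\<lambda>x. x\<^sup>2)"
  by (rule integrableI_nonneg) (use second_moment in \<open>auto simp: less_top[symmetric] top_unique\<close>)

lemma integral_square_le: "(\<integral>x. x\<^sup>2 \<partial>N) \<le> 1"
  using second_moment by (subst (asm) nn_integral_eq_integral[OF integrable_square]) auto

lemma integrable_id: "integrable N (\<lambda>x. x)"
proof (rule Bochner_Integration.integrable_bound)
  show "integrable N (\<lambda>x. 1 + x\<^sup>2)" using integrable_square by simp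
  have "\<bar>x\<bar> \<le> 1 + x\<^sup>2" for x :: real
    using zero_le_power2[of "\<bar>x\<bar> - 1"] by (simp add: power2_diff)
  thus "AE x in N. norm x \<le> norm (1 + x\<^sup>2)" by (auto intro!: AE_I2 order.trans)
qed simp

lemma abs_mean_le_1: "\<bar>\<integral>x. x \<partial>N\<bar> \<le> 1"
proof -
  have "\<bar>\<integral>x. x \<partial>N\<bar> \<le> (\<integral>x. \<bar>x\<bar> \<partial>N)" by (rule integral_abs_bound)
  also have "\<dots> \<le> (\<integral>x. (1 + x\<^sup>2) / 2 \<partial>N)"
  proof (rule integral_mono)
    show "\<bar>x\<bar> \<le> (1 + x\<^sup>2) / 2" for x :: real
      using zero_le_power2[of "\<bar>x\<bar> - 1"] by (simp add: power2_diff)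
  qed (use integrable_id integrable_square in auto)
  also have "\<dots> = (1 + (\<integral>x. x\<^sup>2 \<partial>N)) / 2" using integrable_square by (simp add: prob_space)
  also have "\<dots> \<le> 1" using integral_square_le by simp
  finally show ?thesis .
qed

lemma integrable_sat: "B \<ge> 0 \<Longrightarrow> integrable N (\<lambda>x. sat x B)"
  by (rule integrable_const_bound[where B = B]) (auto simp: abs_sat_le)

lemma sat_bias:
  assumes "B > 0"
  shows "\<bar>(\<integral>x. sat x B \<partial>N) - (\<integral>x. x \<partial>N)\<bar> \<le> 1 / B"
proof -
  have "(\<integral>x. sat x B \<partial>N) - (\<integral>x. x \<partial>N) = (\<integral>x. sat x B - x \<partial>N)"
    using integrable_sat integrable_id assms by simp
  also have "\<bar>\<dots>\<bar> \<le> (\<integral>x. \<bar>sat x B - x\<bar> \<partial>N)" by (rule integral_abs_bound)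
  also have "\<dots> \<le> (\<integral>x. x\<^sup>2 / B \<partial>N)"
    using integrable_sat integrable_id integrable_square assms by (intro integral_mono abs_diff_sat_le) auto
  also have "\<dots> = (\<integral>x. x\<^sup>2 \<partial>N) / B" by simp
  also have "\<dots> \<le> 1 / B" using integral_square_le assms by (intro divide_right_mono) auto
  finally show ?thesis .
qed

text \<open>The sign \<sigma> covers both tails. The range c may exceed \<open>2 * B\<close> because
  the overshoot uses the larger \<open>up_scale\<close>; the variance is at most 1 since truncation
  lowers second moments.\<close>

lemma sat_mgf:
  assumes "B > 0" "2 * B \<le> c" "l > 0" "\<sigma> = 1 \<or> \<sigma> = -1"
  shows "(\<integral>\<^sup>+x. ennreal (exp (l * (\<sigma> * (sat x B - (\<integral>y. sat y B \<partial>N))) - (exp (l * c) - 1 - l * c) / c\<^sup>2)) \<partial>N) \<le> 1"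
proof (rule bennett_mgf)
  define m where "m = (\<integral>y. sat y B \<partial>N)"
  have iB: "integrable N (\<lambda>x. sat x B)" using assms by (intro integrable_sat) auto
  have iB2: "integrable N (\<lambda>x. (sat x B)\<^sup>2)"
  proof (rule integrable_const_bound[where B = "B\<^sup>2"])
    show "AE x in N. norm ((sat x B)\<^sup>2) \<le> B\<^sup>2"
      using abs_sat_le[of B] assms by (auto intro!: AE_I2 simp: abs_le_square_iff[symmetric])
  qed auto
  have "\<bar>m\<bar> \<le> (\<integral>x. \<bar>sat x B\<bar> \<partial>N)" unfolding m_def by (rule integral_abs_bound)
  also have "\<dots> \<le> (\<integral>x. B \<partial>N)" using iB assms by (intro integral_mono abs_sat_le) auto
  finally have "\<bar>m\<bar> \<le> B" by (simp add: prob_space)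
  thus "\<bar>\<sigma> * (sat x B - (\<integral>y. sat y B \<partial>N))\<bar> \<le> c" for x
    using abs_sat_le[of B x] assms unfolding m_def[symmetric] by (auto simp: abs_mult)
  show "expectation (\<lambda>x. \<sigma> * (sat x B - (\<integral>y. sat y B \<partial>N))) = 0"
    using iB by (simp add: prob_space)
  have "(\<sigma> * (sat x B - m))\<^sup>2 = (sat x B)\<^sup>2 - 2 * m * sat x B + m\<^sup>2" for x
    using assms(4) by (auto simp: power2_eq_square algebra_simps)
  hence "expectation (\<lambda>x. (\<sigma> * (sat x B - m))\<^sup>2) = expectation (\<lambda>x. (sat x B)\<^sup>2 - 2 * m * sat x B + m\<^sup>2)"
    by simp
  also have "\<dots> = expectation (\<lambda>x. (sat x B)\<^sup>2) - 2 * m * m + m\<^sup>2"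
    using iB iB2 by (simp add: prob_space m_def)
  also have "\<dots> \<le> expectation (\<lambda>x. (sat x B)\<^sup>2)" by (simp add: power2_eq_square)
  also have "\<dots> \<le> expectation (\<lambda>x. x\<^sup>2)"
    using iB2 integrable_square abs_sat_le_abs[of B] assms
    by (intro integral_mono) (auto simp: abs_le_square_iff[symmetric])
  also have "\<dots> \<le> 1" by (rule integral_square_le)
  finally show "expectation (\<lambda>x. (\<sigma> * (sat x B - (\<integral>y. sat y B \<partial>N)))\<^sup>2) \<le> 1" by (simp add: m_def)
qed (use assms in auto)

end

section \<open>The random environment: measurability and supermartingale bounds\<close>

locale rrmoss_env = rrmoss +
  fixes M :: "nat \<times> nat \<Rightarrow> real measure" and T :: nat
  assumes M: "\<And>i. reward_dist (M i)"
begin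

sublocale product_prob_space M "{Suc 0..T} \<times> {Suc 0..K}"
  by (rule product_prob_spaceI) (use M in \<open>auto simp: reward_dist_def\<close>)

abbreviation P where "P \<equiv> Pi\<^sub>M ({Suc 0..T} \<times> {Suc 0..K}) M"

sublocale P: prob_space P by (intro prob_space_PiM prob_space)

definition mu :: "nat \<Rightarrow> nat \<Rightarrow> real" where "mu t k = (\<integral>x. x \<partial>M (t, k))"

definition musat :: "nat \<Rightarrow> nat \<Rightarrow> real \<Rightarrow> real" where "musat t k B = (\<integral>x. sat x B \<partial>M (t, k))"

lemma sets_M [measurable_cong]: "sets (M i) = sets borel"
  using M[of i] by (simp add: reward_dist_def reward_dist_axioms_def)

lemma abs_mu_le: "\<bar>mu t k\<bar> \<le> 1" unfolding mu_def using M by (rule reward_dist.abs_mean_le_1)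

lemma musat_bias: "B > 0 \<Longrightarrow> \<bar>musat t k B - mu t k\<bar> \<le> 1 / B"
  unfolding musat_def mu_def using M by (rule reward_dist.sat_bias)

lemma reward_measurable:
  "t \<in> {1..T} \<Longrightarrow> k \<in> {1..K} \<Longrightarrow> (\<lambda>\<omega>. \<omega> (t, k)) \<in> borel_measurable P"
  using measurable_component_singleton[of "(t, k)" "{Suc 0..T} \<times> {Suc 0..K}" M]
  by (simp add: measurable_cong_sets[OF refl sets_M])

lemma cnt_measurable_if:
  assumes "\<And>s. s \<in> {Suc t0..<t} \<Longrightarrow> (\<lambda>\<omega>. arm \<omega> s) \<in> P \<rightarrow>\<^sub>M count_space UNIV"
  shows "(\<lambda>\<omega>. cnt \<omega> t0 t k) \<in> P \<rightarrow>\<^sub>M count_space UNIV"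
proof -
  have "(\<lambda>\<omega>. if arm \<omega> s = k then 1 else 0 :: nat) \<in> P \<rightarrow>\<^sub>M count_space UNIV"
    if "s \<in> {Suc t0..<t}" for s
  proof -
    note [measurable] = assms[OF that]
    show ?thesis by measurable
  qed
  hence "(\<lambda>\<omega>. \<Sum>s\<in>{Suc t0..<t}. if arm \<omega> s = k then 1 else 0 :: nat) \<in> P \<rightarrow>\<^sub>M count_space UNIV"
    by (rule measurable_sum_nat)
  moreover have "cnt \<omega> t0 t k = (\<Sum>s\<in>{Suc t0..<t}. if arm \<omega> s = k then 1 else 0)" for \<omega>
    unfolding cnt_def by (simp add: sum.If_cases Int_def)
  ultimately show ?thesis by simp
qed

text \<open>Strong induction: earlier arms of the epoch give the counts, counts and rewards give the
  indices, and the selected arm is a \<open>LEAST\<close> of measurable predicates.\<close>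

lemma arm_measurable: "t \<in> {1..T} \<Longrightarrow> (\<lambda>\<omega>. arm \<omega> t) \<in> P \<rightarrow>\<^sub>M count_space UNIV"
proof (induction t rule: less_induct)
  case (less t)
  define t0 where "t0 = (t - 1) div \<tau> * \<tau>"
  have tau: "\<tau> > 0" using K K_tau by simp
  have "t - 1 = t0 + (t - 1) mod \<tau>" "(t - 1) mod \<tau> < \<tau>" using tau by (simp_all add: t0_def)
  hence t: "t0 < t" "t \<le> t0 + \<tau>" using less.prems by (auto simp del: One_nat_def)
  have d: "\<tau> dvd t0" by (simp add: t0_def)
  have arms [measurable]: "(\<lambda>\<omega>. arm \<omega> s) \<in> P \<rightarrow>\<^sub>M count_space UNIV" if "s \<in> {Suc t0..<t}" for s
    using that less.prems by (intro less.IH) auto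
  have cnt_m [measurable]: "(\<lambda>\<omega>. cnt \<omega> t0 t k) \<in> P \<rightarrow>\<^sub>M count_space UNIV" for k
    using arms by (rule cnt_measurable_if)
  \<comment> \<open>Counts are discrete, so random truncation levels and bonuses are measurable
    whatever their form.\<close>
  have cnt_fun_m [measurable]: "(\<lambda>\<omega>. g (cnt \<omega> t0 t k)) \<in> borel_measurable P" for k and g :: "nat \<Rightarrow> real"
    using measurable_compose[OF cnt_m[of k], of g borel] by simp
  have idx_m: "(\<lambda>\<omega>. idx \<omega> t0 t k) \<in> borel_measurable P" if k: "k \<in> {1..K}" for k
  proof -
    have "(\<lambda>\<omega>. if arm \<omega> s = k then sat (\<omega> (s, k)) (Bm a (real \<tau>) K (cnt \<omega> t0 t k)) else 0) \<in> borel_measurable P"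
      if s: "s \<in> {Suc t0..<t}" for s
    proof -
      have [measurable]: "(\<lambda>\<omega>. \<omega> (s, k)) \<in> borel_measurable P"
        using s k less.prems by (intro reward_measurable) auto
      note [measurable] = arms[OF s]
      show ?thesis by measurable
    qed
    hence [measurable]: "(\<lambda>\<omega>. satsum \<omega> t0 t k (Bm a (real \<tau>) K (cnt \<omega> t0 t k))) \<in> borel_measurable P"
      unfolding satsum_def by (intro borel_measurable_sum)
    show ?thesis unfolding idx_def by measurable
  qed
  have "Measurable.pred P (\<lambda>\<omega>. k \<in> {1..K} \<and> (\<forall>j\<in>{1..K}. idx \<omega> t0 t j \<le> idx \<omega> t0 t k))" for k
  proof (cases "k \<in> {1..K}")
    case True
    have "Measurable.pred P (\<lambda>\<omega>. idx \<omega> t0 t j \<le> idx \<omega> t0 t k)" if "j \<in> {1..K}" for j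
      unfolding Measurable.pred_def using idx_m[OF that] idx_m[OF True] by (rule borel_measurable_le)
    hence "Measurable.pred P (\<lambda>\<omega>. \<forall>j\<in>{1..K}. idx \<omega> t0 t j \<le> idx \<omega> t0 t k)"
      by (intro pred_intros_finite) auto
    thus ?thesis using True by simp
  next
    case False
    hence eq: "(\<lambda>\<omega>. k \<in> {1..K} \<and> (\<forall>j\<in>{1..K}. idx \<omega> t0 t j \<le> idx \<omega> t0 t k)) = (\<lambda>_. False)" by blast
    show ?thesis unfolding eq by measurable
  qed
  hence "(\<lambda>\<omega>. LEAST k. k \<in> {1..K} \<and> (\<forall>j\<in>{1..K}. idx \<omega> t0 t j \<le> idx \<omega> t0 t k)) \<in> P \<rightarrow>\<^sub>M count_space UNIV"
    by (rule measurable_Least)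
  thus ?case unfolding arm_eq[OF d t] by (cases "t - Suc t0 < K") (simp_all only: if_True if_False measurable_const space_count_space UNIV_I)
qed

lemma cnt_measurable: "t \<le> Suc T \<Longrightarrow> (\<lambda>\<omega>. cnt \<omega> t0 t k) \<in> P \<rightarrow>\<^sub>M count_space UNIV"
  by (rule cnt_measurable_if, rule arm_measurable) auto

text \<open>For a fixed arm the coordinates \<open>(s, k)\<close> with varying s are used, including
  rewards never observed; the switch \<open>A s\<close> discards those.\<close>

lemma predictable_prod_expectation:
  fixes A :: "nat \<Rightarrow> (nat \<times> nat \<Rightarrow> real) \<Rightarrow> bool" and g :: "nat \<Rightarrow> real \<Rightarrow> real"
  assumes k: "k \<in> {1..K}" and t: "t \<le> Suc T"
    and A: "\<And>s. s \<in> {Suc t0..<t} \<Longrightarrow> Measurable.pred P (A s)"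
    and inv: "\<And>r s \<omega> y. r \<le> s \<Longrightarrow> A r (fun_upd \<omega> (s, k) y) = A r \<omega>"
    and g [measurable]: "\<And>s. g s \<in> borel_measurable borel"
    and le: "\<And>s. (\<integral>\<^sup>+x. ennreal (exp (g s x)) \<partial>M (s, k)) \<le> 1"
  shows "integrable P (\<lambda>\<omega>. \<Prod>s\<in>{Suc t0..<t}. if A s \<omega> then exp (g s (\<omega> (s, k))) else 1)" (is "integrable P ?W")
    and "(\<integral>\<omega>. (\<Prod>s\<in>{Suc t0..<t}. if A s \<omega> then exp (g s (\<omega> (s, k))) else 1) \<partial>P) \<le> 1"
proof -
  have nn: "?W \<omega> \<ge> 0" for \<omega> by (intro prod_nonneg) auto
  have meas: "?W \<in> borel_measurable P"
  proof (rule borel_measurable_prod)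
    fix s assume s: "s \<in> {Suc t0..<t}"
    note [measurable] = A[OF s]
    have [measurable]: "(\<lambda>\<omega>. \<omega> (s, k)) \<in> borel_measurable P"
      using s k t by (intro reward_measurable) auto
    show "(\<lambda>\<omega>. if A s \<omega> then exp (g s (\<omega> (s, k))) else 1) \<in> borel_measurable P" by measurable
  qed
  have "(\<integral>\<^sup>+\<omega>. (\<Prod>s\<in>{Suc t0..<t}. if A s \<omega> then ennreal (exp (g s (\<omega> (s, k)))) else 1) \<partial>P) \<le> 1"
  proof (rule nn_integral_predictable_prod_le_1)
    show "inj (\<lambda>s. (s, k))" by (auto intro: injI)
    show "(\<lambda>x. ennreal (exp (g s x))) \<in> borel_measurable (M (s, k))" for s by measurable
    show "A r (fun_upd \<omega> (s, k) y) = A r \<omega>" if "r \<le> s" for r s \<omega> y using that by (rule inv)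
  qed (use k t A le in auto)
  also have "(\<lambda>\<omega>. \<Prod>s\<in>{Suc t0..<t}. if A s \<omega> then ennreal (exp (g s (\<omega> (s, k)))) else 1) = (\<lambda>\<omega>. ennreal (?W \<omega>))"
    by (auto simp: fun_eq_iff prod_ennreal[symmetric] intro!: prod.cong)
  finally have le1: "(\<integral>\<^sup>+\<omega>. ennreal (?W \<omega>) \<partial>P) \<le> 1" .
  show i: "integrable P ?W"
    using meas nn le1 by (intro integrableI_nonneg) (auto simp: less_top[symmetric] top_unique)
  show "(\<integral>\<omega>. ?W \<omega> \<partial>P) \<le> 1"
    using le1 nn by (subst (asm) nn_integral_eq_integral[OF i]) auto
qed

lemma low_prod_expectation:
  assumes k: "k \<in> {1..K}" and t: "t \<le> Suc T"
  shows "integrable P (low_prod musat t0 t k j)" "(\<integral>\<omega>. low_prod musat t0 t k j \<omega> \<partial>P) \<le> 1"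
proof -
  have le: "(\<integral>\<^sup>+x. ennreal (exp (lowlam j * (musat s k (block_level j) - sat x (block_level j)) - lowG j)) \<partial>M (s, k)) \<le> 1" for s
    using reward_dist.sat_mgf[OF M, of "block_level j" "2 * block_level j" "lowlam j" "-1" "(s, k)"]
      block_level_pos[of j] lowlam_pos[of j] by (simp add: lowG_def musat_def)
  have "Measurable.pred P (\<lambda>\<omega>. arm \<omega> s = k)" if "s \<in> {Suc t0..<t}" for s
  proof -
    have [measurable]: "(\<lambda>\<omega>. arm \<omega> s) \<in> P \<rightarrow>\<^sub>M count_space UNIV" using that t by (intro arm_measurable) auto
    show ?thesis by measurable
  qed
  note * = predictable_prod_expectation[of k t t0 "\<lambda>s \<omega>. arm \<omega> s = k"
    "\<lambda>s x. lowlam j * (musat s k (block_level j) - sat x (block_level j)) - lowG j", OF k t this _ _ le]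
  show "integrable P (low_prod musat t0 t k j)"
    unfolding low_prod_def[abs_def] by (rule *(1)) (auto simp: arm_upd)
  show "(\<integral>\<omega>. low_prod musat t0 t k j \<omega> \<partial>P) \<le> 1"
    unfolding low_prod_def by (rule *(2)) (auto simp: arm_upd)
qed

lemma up_prod_expectation:
  assumes k: "k \<in> {1..K}" and t: "t1 \<le> Suc T" and n: "n \<ge> 1"
  shows "integrable P (up_prod musat t0 t1 k n)" "(\<integral>\<omega>. up_prod musat t0 t1 k n \<omega> \<partial>P) \<le> 1"
proof -
  define B where "B = Bm a (real \<tau>) K n"
  have tau: "real \<tau> > 0" using K K_tau by simp
  note Bb = inverse_Bm_le_cm[OF a tau K n, folded B_def]
  have u0: "up_scale n > 0" "2 * B \<le> up_scale n" using a n Bb by (auto simp: up_scale_def)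
  have le: "(\<integral>\<^sup>+x. ennreal (exp (1 / up_scale n * (sat x B - musat s k B) - upG n)) \<partial>M (s, k)) \<le> 1" for s
    using reward_dist.sat_mgf[OF M, of B "up_scale n" "1 / up_scale n" 1 "(s, k)"]
      Bb u0 by (simp add: upG_def musat_def)
  have "Measurable.pred P (\<lambda>\<omega>. arm \<omega> s = k \<and> cnt \<omega> t0 s k < n)" if "s \<in> {Suc t0..<t1}" for s
  proof -
    have [measurable]: "(\<lambda>\<omega>. arm \<omega> s) \<in> P \<rightarrow>\<^sub>M count_space UNIV"
      "(\<lambda>\<omega>. cnt \<omega> t0 s k) \<in> P \<rightarrow>\<^sub>M count_space UNIV"
      using that t by (intro arm_measurable cnt_measurable; auto)+
    show ?thesis by measurable
  qed
  note * = predictable_prod_expectation[of k t1 t0 "\<lambda>s \<omega>. arm \<omega> s = k \<and> cnt \<omega> t0 s k < n"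
    "\<lambda>s x. 1 / up_scale n * (sat x B - musat s k B) - upG n", OF k t this _ _ le]
  show "integrable P (up_prod musat t0 t1 k n)"
    unfolding up_prod_def[abs_def] B_def[symmetric] by (rule *(1)) (auto simp: arm_upd cnt_upd)
  show "(\<integral>\<omega>. up_prod musat t0 t1 k n \<omega> \<partial>P) \<le> 1"
    unfolding up_prod_def B_def[symmetric] by (rule *(2)) (auto simp: arm_upd cnt_upd)
qed

end

section \<open>Expected regret\<close>

text \<open>The 4 is 2 for the initial pulls plus 2 for the margins \<open>2 * epsilon\<close>; the
  other terms come from \<open>lowcoef_sum\<close>, \<open>upcoef_sum\<close>, and
  \<open>sum_cm_excess\<close> at \<open>\<kappa> = 2 + \<zeta>\<close>.\<close>

definition regret_const :: "real \<Rightarrow> real \<Rightarrow> real" where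
  "regret_const a \<zeta> = 4 + \<zeta>\<^sup>2 / (1 - 1 / sqrt a) + 32 * a + 8 * (2 + \<zeta>)\<^sup>2"

context rrmoss_env
begin

definition best :: "nat \<Rightarrow> nat" where
  "best t = (SOME k. k \<in> {1..K} \<and> mu t k = Max (mu t ` {1..K}))"

lemma best: "best t \<in> {1..K}" "mu t (best t) = Max (mu t ` {1..K})"
proof -
  have "Max (mu t ` {1..K}) \<in> mu t ` {1..K}" using K by (intro Max_in) auto
  hence "\<exists>k. k \<in> {1..K} \<and> mu t k = Max (mu t ` {1..K})" by auto
  from someI_ex[OF this] show "best t \<in> {1..K}" "mu t (best t) = Max (mu t ` {1..K})"
    by (simp_all add: best_def)
qed

definition nblocks :: nat where "nblocks = Suc (nat \<lfloor>log a (real \<tau>)\<rfloor>)"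

definition lowdev :: "nat \<Rightarrow> nat \<Rightarrow> (nat \<times> nat \<Rightarrow> real) \<Rightarrow> real" where
  "lowdev t0 t \<omega> = (\<Sum>j<nblocks. lowcoef j * low_prod musat t0 t (best t) j \<omega>)"

definition updev :: "nat \<Rightarrow> nat \<Rightarrow> nat \<times> nat \<Rightarrow> (nat \<times> nat \<Rightarrow> real) \<Rightarrow> real" where
  "updev t0 t1 = (\<lambda>(k, n) \<omega>. upcoef n * up_prod musat t0 t1 k n \<omega> + max 0 ((2 + \<zeta>) * cm (real \<tau>) K n - epsilon / 2))"

definition epoch_bound :: "real \<Rightarrow> nat \<Rightarrow> nat \<Rightarrow> (nat \<times> nat \<Rightarrow> real) \<Rightarrow> real" where
  "epoch_bound v t0 t1 \<omega> = 2 * real K + real \<tau> * (2 * v + 2 * epsilon)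
     + (\<Sum>t\<in>{Suc t0..<t1}. lowdev t0 t \<omega>) + (\<Sum>p\<in>{1..K} \<times> {1..\<tau>}. updev t0 t1 p \<omega>)"

lemma lowdev_nonneg: "lowdev t0 t \<omega> \<ge> 0"
  unfolding lowdev_def using lowcoef_nonneg by (intro sum_nonneg mult_nonneg_nonneg) (auto simp: low_prod_eq)

lemma updev_nonneg: "updev t0 t1 p \<omega> \<ge> 0"
  unfolding updev_def up_prod_def using upcoef_nonneg
  by (auto split: prod.split intro!: add_nonneg_nonneg mult_nonneg_nonneg prod_nonneg)

lemma epoch_regret_le:
  assumes psi: "psi (2 * \<zeta> / a) \<ge> 2 * a / \<zeta>"
    and d: "\<tau> dvd t0" and t1: "t1 \<le> Suc (t0 + \<tau>)"
    and v0: "v \<ge> 0"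
    and v: "\<And>s t k. s \<in> {Suc t0..<t1} \<Longrightarrow> t \<in> {Suc t0..<t1} \<Longrightarrow> k \<in> {1..K} \<Longrightarrow> \<bar>mu s k - mu t k\<bar> \<le> v"
  shows "(\<Sum>t\<in>{Suc t0..<t1}. Max (mu t ` {1..K}) - mu t (arm \<omega> t)) \<le> epoch_bound v t0 t1 \<omega>"
proof -
  define A where "A = {Suc t0..<t1}"
  define g where "g t = (arm \<omega> t, cnt \<omega> t0 t (arm \<omega> t))" for t
  define late where "late = {t \<in> A. t0 + K < t}"
  have pw: "Max (mu t ` {1..K}) - mu t (arm \<omega> t)
      \<le> (if t \<le> t0 + K then 2 else 0) + (2 * v + 2 * epsilon) + lowdev t0 t \<omega>
        + (if t0 + K < t then updev t0 t1 (g t) \<omega> else 0)" if t: "t \<in> A" for t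
  \<comment> \<open>In the initial round no index comparison is available; the regret is at most 2
    because all means lie in \<open>[-1, 1]\<close>.\<close>
  proof (cases "t \<le> t0 + K")
    case True
    have "Max (mu t ` {1..K}) - mu t (arm \<omega> t) \<le> 2"
      using abs_mu_le[of t "best t"] abs_mu_le[of t "arm \<omega> t"] best(2)[of t] by linarith
    thus ?thesis using True lowdev_nonneg[of t0 t \<omega>] v0 epsilon_pos by simp
  next
    case False
    have t': "t0 + K < t" "t \<le> t0 + \<tau>" "t < t1" using t False t1 by (auto simp: A_def)
    define k where "k = arm \<omega> t"
    define n where "n = cnt \<omega> t0 t k"
    have k: "k \<in> {1..K}" using arm_range by (simp add: k_def)
    have n: "n \<ge> 1" unfolding n_def by (rule cnt_pos[OF d t'(1) k])
    have "max 0 ((mu t (best t) - v) - epsilon - idx \<omega> t0 t (best t)) \<le> lowdev t0 t \<omega>"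
      unfolding lowdev_def
    proof (rule idx_lower_bound[OF d t'(1,2) best(1) psi])
      fix s and B :: real assume s: "s \<in> {Suc t0..<t}" and B: "B > 0"
      have "\<bar>mu s (best t) - mu t (best t)\<bar> \<le> v" using s t best(1) by (intro v) (auto simp: A_def)
      thus "musat s (best t) B \<ge> (mu t (best t) - v) - 1 / B"
        using musat_bias[OF B, of s "best t"] by linarith
    qed (simp add: nblocks_def)
    moreover have "max 0 (idx \<omega> t0 t k - (mu t k + v) - epsilon) \<le> updev t0 t1 (g t) \<omega>"
      unfolding updev_def g_def prod.case k_def[symmetric] n_def[symmetric]
    proof (rule idx_upper_bound[OF t'(3) n n_def[symmetric]])
      fix s and B :: real assume s: "s \<in> {Suc t0..<t}" and B: "B > 0"
      have "\<bar>mu s k - mu t k\<bar> \<le> v" using s t k by (intro v) (auto simp: A_def)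
      thus "musat s k B \<le> (mu t k + v) + 1 / B"
        using musat_bias[OF B, of s k] by linarith
    qed
    moreover have "idx \<omega> t0 t (best t) \<le> idx \<omega> t0 t k"
      unfolding k_def by (rule idx_le_idx_arm[OF d t'(1,2) best(1)])
    ultimately show ?thesis using False unfolding best(2)[symmetric] k_def[symmetric] by simp
  qed
  have "(\<Sum>t\<in>A. Max (mu t ` {1..K}) - mu t (arm \<omega> t))
     \<le> (\<Sum>t\<in>A. (if t \<le> t0 + K then 2 else 0) + (2 * v + 2 * epsilon) + lowdev t0 t \<omega>
        + (if t0 + K < t then updev t0 t1 (g t) \<omega> else 0))"
    by (rule sum_mono) (rule pw)
  also have "\<dots> = (\<Sum>t\<in>A. if t \<le> t0 + K then 2 else 0) + real (card A) * (2 * v + 2 * epsilon)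
       + (\<Sum>t\<in>A. lowdev t0 t \<omega>) + (\<Sum>t\<in>A. if t0 + K < t then updev t0 t1 (g t) \<omega> else 0)"
    by (simp add: sum.distrib)
  also have "\<dots> \<le> 2 * real K + real \<tau> * (2 * v + 2 * epsilon)
       + (\<Sum>t\<in>A. lowdev t0 t \<omega>) + (\<Sum>p\<in>{1..K} \<times> {1..\<tau>}. updev t0 t1 p \<omega>)"
  proof (intro add_mono order_refl)
    have "(\<Sum>t\<in>A. if t \<le> t0 + K then 2 else 0) = 2 * real (card (A \<inter> {t. t \<le> t0 + K}))"
      by (simp add: sum.If_cases A_def)
    also have "card (A \<inter> {t. t \<le> t0 + K}) \<le> card {Suc t0..t0 + K}"
      by (intro card_mono) (auto simp: A_def)
    finally show "(\<Sum>t\<in>A. if t \<le> t0 + K then 2 else 0) \<le> 2 * real K" by simp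
    have "card A \<le> \<tau>" using t1 by (simp add: A_def)
    thus "real (card A) * (2 * v + 2 * epsilon) \<le> real \<tau> * (2 * v + 2 * epsilon)"
      using v0 epsilon_pos by (intro mult_right_mono) auto
    \<comment> \<open>Distinct late times give distinct pairs of arm and count, so the sum over
      times is at most a sum over all pairs, whose index set is no longer random.\<close>
    have "(\<Sum>t\<in>A. if t0 + K < t then updev t0 t1 (g t) \<omega> else 0) = (\<Sum>t\<in>late. updev t0 t1 (g t) \<omega>)"
      unfolding late_def by (rule sum.inter_filter[symmetric]) (simp add: A_def)
    also have "\<dots> = (\<Sum>p\<in>g ` late. updev t0 t1 p \<omega>)"
    proof (rule sum.reindex_cong[symmetric, OF _ refl refl])
      show "inj_on g late" unfolding g_def using pull_number_inj
        by (rule inj_on_subset) (auto simp: late_def A_def)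
    qed
    also have "\<dots> \<le> (\<Sum>p\<in>{1..K} \<times> {1..\<tau>}. updev t0 t1 p \<omega>)"
    proof (rule sum_mono2)
      show "g ` late \<subseteq> {1..K} \<times> {1..\<tau>}"
      proof
        fix p assume "p \<in> g ` late"
        then obtain t where t: "t \<in> A" "t0 + K < t" "p = g t" by (auto simp: late_def)
        have "cnt \<omega> t0 t (arm \<omega> t) \<le> \<tau>" using cnt_le[of \<omega> t0 t "arm \<omega> t"] t t1 by (auto simp: A_def)
        thus "p \<in> {1..K} \<times> {1..\<tau>}" using t(3) arm_range[of \<omega> t] cnt_pos[OF d t(2) arm_range[of \<omega> t]]
          by (auto simp: g_def)
      qed
    qed (auto intro: updev_nonneg)
    finally show "(\<Sum>t\<in>A. if t0 + K < t then updev t0 t1 (g t) \<omega> else 0) \<le> (\<Sum>p\<in>{1..K} \<times> {1..\<tau>}. updev t0 t1 p \<omega>)" .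
  qed
  finally show ?thesis unfolding epoch_bound_def A_def .
qed

lemma epoch_bound_nonneg: "v \<ge> 0 \<Longrightarrow> epoch_bound v t0 t1 \<omega> \<ge> 0"
  unfolding epoch_bound_def using epsilon_pos
  by (intro add_nonneg_nonneg sum_nonneg lowdev_nonneg updev_nonneg) auto

lemma epoch_bound_expectation:
  assumes v0: "v \<ge> 0" and t1: "t1 \<le> Suc (t0 + \<tau>)" "t1 \<le> Suc T"
  shows "integrable P (epoch_bound v t0 t1)"
    and "(\<integral>\<omega>. epoch_bound v t0 t1 \<omega> \<partial>P) \<le> 2 * real \<tau> * v + regret_const a \<zeta> * sqrt (real K * real \<tau>)"
proof -
  have tau: "real \<tau> > 0" using K K_tau by simp
  have low_i: "integrable P (lowdev t0 t)"
    and low_e: "(\<integral>\<omega>. lowdev t0 t \<omega> \<partial>P) \<le> \<zeta>\<^sup>2 / (1 - 1 / sqrt a) * epsilon" if "t \<in> {Suc t0..<t1}" for t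
  proof -
    have t: "t \<le> Suc T" using that t1 by simp
    note * = low_prod_expectation[OF best(1)[of t] t, of t0]
    show "integrable P (lowdev t0 t)" unfolding lowdev_def[abs_def] using *(1) by simp
    have "(\<integral>\<omega>. lowdev t0 t \<omega> \<partial>P) = (\<Sum>j<nblocks. lowcoef j * (\<integral>\<omega>. low_prod musat t0 t (best t) j \<omega> \<partial>P))"
      unfolding lowdev_def using *(1) by simp
    also have "\<dots> \<le> (\<Sum>j<nblocks. lowcoef j)"
      using *(2) lowcoef_nonneg by (intro sum_mono mult_left_le) auto
    also have "\<dots> \<le> \<zeta>\<^sup>2 / (1 - 1 / sqrt a) * epsilon" by (rule lowcoef_sum)
    finally show "(\<integral>\<omega>. lowdev t0 t \<omega> \<partial>P) \<le> \<zeta>\<^sup>2 / (1 - 1 / sqrt a) * epsilon" .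
  qed
  define c where "c n = max 0 ((2 + \<zeta>) * cm (real \<tau>) K n - epsilon / 2)" for n
  have up_i: "integrable P (updev t0 t1 p)"
    and up_e: "(\<integral>\<omega>. updev t0 t1 p \<omega> \<partial>P) \<le> upcoef (snd p) + c (snd p)" if p: "p \<in> {1..K} \<times> {1..\<tau>}" for p
  proof -
    obtain k n where kn: "p = (k, n)" "k \<in> {1..K}" "n \<ge> 1" using p by auto
    note * = up_prod_expectation[OF kn(2) t1(2) kn(3), of t0]
    show "integrable P (updev t0 t1 p)" unfolding updev_def kn(1) prod.case using *(1) by simp
    have "(\<integral>\<omega>. updev t0 t1 p \<omega> \<partial>P) = upcoef n * (\<integral>\<omega>. up_prod musat t0 t1 k n \<omega> \<partial>P) + c n"
      unfolding updev_def kn(1) prod.case c_def using *(1) by (simp add: P.prob_space)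
    also have "\<dots> \<le> upcoef n + c n" using *(2) upcoef_nonneg by (simp add: mult_left_le)
    finally show "(\<integral>\<omega>. updev t0 t1 p \<omega> \<partial>P) \<le> upcoef (snd p) + c (snd p)" using kn by simp
  qed
  show "integrable P (epoch_bound v t0 t1)"
    unfolding epoch_bound_def[abs_def] using low_i up_i by (intro Bochner_Integration.integrable_add Bochner_Integration.integrable_sum) auto
  have "(\<integral>\<omega>. epoch_bound v t0 t1 \<omega> \<partial>P) = 2 * real K + real \<tau> * (2 * v + 2 * epsilon)
     + (\<Sum>t\<in>{Suc t0..<t1}. \<integral>\<omega>. lowdev t0 t \<omega> \<partial>P) + (\<Sum>p\<in>{1..K} \<times> {1..\<tau>}. \<integral>\<omega>. updev t0 t1 p \<omega> \<partial>P)"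
  proof -
    have "integrable P (\<lambda>\<omega>. \<Sum>t\<in>{Suc t0..<t1}. lowdev t0 t \<omega>)"
      "integrable P (\<lambda>\<omega>. \<Sum>p\<in>{1..K} \<times> {1..\<tau>}. updev t0 t1 p \<omega>)"
      using low_i up_i by (intro Bochner_Integration.integrable_sum; blast)+
    thus ?thesis unfolding epoch_bound_def using low_i up_i
      by (simp add: P.prob_space Bochner_Integration.integral_sum)
  qed
  also have "\<dots> \<le> 2 * (real \<tau> * epsilon) + real \<tau> * (2 * v + 2 * epsilon)
     + real \<tau> * (\<zeta>\<^sup>2 / (1 - 1 / sqrt a) * epsilon) + (32 * a + 8 * (2 + \<zeta>)\<^sup>2) * (real \<tau> * epsilon)"
  proof (intro add_mono order_refl)
    \<comment> \<open>The balance behind the choice of \<open>epsilon\<close>. Together with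
      \<open>epsilon \<le> 1\<close> it also absorbs the \<open>K\<close> initial pulls.\<close>
    have Ke: "real K / epsilon = real \<tau> * epsilon"
    proof -
      have "real \<tau> * (epsilon * epsilon) = real K" using tau by (simp add: epsilon_def)
      thus ?thesis using epsilon_pos by (simp add: field_simps)
    qed
    have "epsilon \<le> 1" using K_tau tau by (simp add: epsilon_def)
    hence "real K \<le> real K / epsilon" using epsilon_pos by (simp add: field_simps mult_left_le)
    thus "2 * real K \<le> 2 * (real \<tau> * epsilon)" using Ke by simp
    have L0: "\<zeta>\<^sup>2 / (1 - 1 / sqrt a) * epsilon \<ge> 0" using a epsilon_pos by simp
    have "(\<Sum>t\<in>{Suc t0..<t1}. \<integral>\<omega>. lowdev t0 t \<omega> \<partial>P) \<le> (\<Sum>t\<in>{Suc t0..<t1}. \<zeta>\<^sup>2 / (1 - 1 / sqrt a) * epsilon)"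
      by (intro sum_mono low_e)
    also have "\<dots> = real (t1 - Suc t0) * (\<zeta>\<^sup>2 / (1 - 1 / sqrt a) * epsilon)" by simp
    also have "\<dots> \<le> real \<tau> * (\<zeta>\<^sup>2 / (1 - 1 / sqrt a) * epsilon)"
      using t1 L0 by (intro mult_right_mono) auto
    finally show "(\<Sum>t\<in>{Suc t0..<t1}. \<integral>\<omega>. lowdev t0 t \<omega> \<partial>P) \<le> real \<tau> * (\<zeta>\<^sup>2 / (1 - 1 / sqrt a) * epsilon)" .
    have "(\<Sum>p\<in>{1..K} \<times> {1..\<tau>}. \<integral>\<omega>. updev t0 t1 p \<omega> \<partial>P) \<le> (\<Sum>p\<in>{1..K} \<times> {1..\<tau>}. upcoef (snd p) + c (snd p))"
      by (intro sum_mono up_e)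
    also have "\<dots> = (\<Sum>k\<in>{1..K}. \<Sum>n\<in>{1..\<tau>}. upcoef n + c n)"
      unfolding sum.cartesian_product by (simp add: case_prod_beta)
    also have "\<dots> = real K * ((\<Sum>n=1..\<tau>. upcoef n) + (\<Sum>n=1..\<tau>. c n))"
      by (simp add: sum.distrib)
    also have "\<dots> \<le> real K * (32 * a / epsilon + 8 * (2 + \<zeta>)\<^sup>2 / epsilon)"
      unfolding c_def using zeta K tau
      by (intro mult_left_mono add_mono upcoef_sum sum_cm_excess) (auto simp: epsilon_def)
    also have "\<dots> = (32 * a + 8 * (2 + \<zeta>)\<^sup>2) * (real K / epsilon)"
      by (simp add: add_divide_distrib[symmetric])
    finally show "(\<Sum>p\<in>{1..K} \<times> {1..\<tau>}. \<integral>\<omega>. updev t0 t1 p \<omega> \<partial>P) \<le> (32 * a + 8 * (2 + \<zeta>)\<^sup>2) * (real \<tau> * epsilon)"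
      unfolding Ke .
  qed
  also have "\<dots> = 2 * real \<tau> * v + regret_const a \<zeta> * (real \<tau> * epsilon)"
    unfolding regret_const_def by (simp add: algebra_simps)
  also have "real \<tau> * epsilon = sqrt (real K * real \<tau>)"
  proof -
    have "real \<tau> * epsilon = sqrt (real \<tau> * real \<tau>) * epsilon" by simp
    also have "\<dots> = sqrt (real K * real \<tau>)"
      unfolding epsilon_def real_sqrt_mult[symmetric] using tau by (simp add: mult.commute)
    finally show ?thesis .
  qed
  finally show "(\<integral>\<omega>. epoch_bound v t0 t1 \<omega> \<partial>P) \<le> 2 * real \<tau> * v + regret_const a \<zeta> * sqrt (real K * real \<tau>)" .
qed

end

section \<open>Summation over the epochs\<close>

lemma sum_epochs:
  fixes g :: "nat \<Rightarrow> real"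
  shows "(\<Sum>t\<in>{1..min (n * \<tau>) T}. g t) = (\<Sum>i<n. \<Sum>t\<in>{Suc (i * \<tau>)..<Suc (min (Suc i * \<tau>) T)}. g t)"
proof (induction n)
  case (Suc n)
  have "{1..min (Suc n * \<tau>) T} = {1..min (n * \<tau>) T} \<union> {Suc (n * \<tau>)..<Suc (min (Suc n * \<tau>) T)}" by auto
  hence "(\<Sum>t\<in>{1..min (Suc n * \<tau>) T}. g t)
      = (\<Sum>t\<in>{1..min (n * \<tau>) T}. g t) + (\<Sum>t\<in>{Suc (n * \<tau>)..<Suc (min (Suc n * \<tau>) T)}. g t)"
    by (simp only:) (intro sum.union_disjoint; auto)
  thus ?case using Suc.IH by simp
qed simp

lemma abs_diff_le_variation:
  fixes f D :: "nat \<Rightarrow> real"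
  assumes "\<And>r. r \<in> {l..<u} \<Longrightarrow> \<bar>f (Suc r) - f r\<bar> \<le> D r" "s \<in> {l..u}" "t \<in> {l..u}"
  shows "\<bar>f s - f t\<bar> \<le> (\<Sum>r\<in>{l..<u}. D r)"
proof -
  have le: "\<bar>f t - f s\<bar> \<le> (\<Sum>r\<in>{l..<u}. D r)" if "l \<le> s" "s \<le> t" "t \<le> u" for s t
  proof -
    have "f t - f s = (\<Sum>r\<in>{s..<t}. f (Suc r) - f r)" using that by (simp add: sum_Suc_diff')
    also have "\<bar>\<dots>\<bar> \<le> (\<Sum>r\<in>{s..<t}. \<bar>f (Suc r) - f r\<bar>)" by (rule sum_abs)
    also have "\<dots> \<le> (\<Sum>r\<in>{s..<t}. D r)" using that assms(1) by (intro sum_mono) auto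
    also have "\<dots> \<le> (\<Sum>r\<in>{l..<u}. D r)"
      using that assms(1) by (intro sum_mono2) (auto intro: order.trans[OF abs_ge_zero])
    finally show ?thesis .
  qed
  show ?thesis using le[of s t] le[of t s] assms by (cases "s \<le> t") (auto simp: abs_minus_commute)
qed

context rrmoss_env
begin

lemma expected_regret_le:
  assumes psi: "psi (2 * \<zeta> / a) \<ge> 2 * a / \<zeta>" and "\<tau> \<le> T"
    and var: "(\<Sum>t\<in>{1..<T}. SUP k\<in>{1..K}. \<bar>mu (Suc t) k - mu t k\<bar>) \<le> V"
  shows "(\<integral>\<omega>. (\<Sum>t\<in>{1..T}. Max (mu t ` {1..K}) - mu t (arm \<omega> t)) \<partial>P)
    \<le> 2 * real \<tau> * V + 2 * regret_const a \<zeta> * (real T * sqrt (real K / real \<tau>))"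
proof -
  have tau: "real \<tau> > 0" "\<tau> > 0" using K K_tau by simp_all
  \<comment> \<open>The value 0 at T lets the variation be summed over all of \<open>{1..T}\<close>,
    in step with the partition into epochs.\<close>
  define D where "D t = (if t < T then SUP k\<in>{1..K}. \<bar>mu (Suc t) k - mu t k\<bar> else 0)" for t
  have D: "\<bar>mu (Suc t) k - mu t k\<bar> \<le> D t" if "t < T" "k \<in> {1..K}" for t k
    unfolding D_def using that by (auto intro!: cSUP_upper)
  have D0: "D t \<ge> 0" for t
  proof (cases "t < T")
    case True
    have "0 \<le> \<bar>mu (Suc t) 1 - mu t 1\<bar>" by simp
    also have "\<dots> \<le> D t" using True K by (intro D) auto
    finally show ?thesis .
  qed (simp add: D_def)
  define N where "N = Suc ((T - 1) div \<tau>)"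
  define b where "b i = Suc (min (Suc i * \<tau>) T)" for i
  \<comment> \<open>The sum also contains the jump into the next epoch. This overestimates the drift
    within the epoch but makes the \<open>v i\<close> add up to the total variation.\<close>
  define v where "v i = (\<Sum>t\<in>{Suc (i * \<tau>)..<b i}. D t)" for i
  have v0: "v i \<ge> 0" for i unfolding v_def using D0 by (intro sum_nonneg) auto
  have NT: "min (N * \<tau>) T = T"
  proof -
    have "T - 1 < N * \<tau>" using tau dividend_less_div_times[of \<tau> "T - 1"] by (simp add: N_def add.commute)
    thus ?thesis by linarith
  qed
  have T1: "real T \<ge> real \<tau>" using \<open>\<tau> \<le> T\<close> by simp
  \<comment> \<open>Rounding the number of epochs up costs a factor 2 at most, since
    \<open>\<tau> \<le> T\<close>.\<close>
  have Nle: "real N \<le> 2 * real T / real \<tau>"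
  proof -
    have "real ((T - 1) div \<tau>) \<le> real (T - 1) / real \<tau>" by (rule of_nat_div_le_of_nat)
    also have "\<dots> \<le> real T / real \<tau>" using tau by (intro divide_right_mono) auto
    finally have "real N \<le> 1 + real T / real \<tau>" by (simp add: N_def)
    also have "1 \<le> real T / real \<tau>" using T1 tau by simp
    finally show ?thesis by simp
  qed
  have sumv: "(\<Sum>i<N. v i) \<le> V"
  proof -
    have "(\<Sum>i<N. v i) = (\<Sum>t\<in>{1..T}. D t)"
      using sum_epochs[of D N \<tau> T] unfolding NT v_def b_def by simp
    also have "\<dots> = (\<Sum>t\<in>{1..<T}. D t)" by (rule sum.mono_neutral_right) (auto simp: D_def)
    also have "\<dots> \<le> V" using var by (simp add: D_def)
    finally show ?thesis .
  qed
  have bi: "b i \<le> Suc (i * \<tau> + \<tau>)" "b i \<le> Suc T" for i by (auto simp: b_def)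
  note E = epoch_bound_expectation[OF v0 bi]
  have "(\<integral>\<omega>. (\<Sum>t\<in>{1..T}. Max (mu t ` {1..K}) - mu t (arm \<omega> t)) \<partial>P)
      \<le> (\<integral>\<omega>. (\<Sum>i<N. epoch_bound (v i) (i * \<tau>) (b i) \<omega>) \<partial>P)"
  proof (rule integral_mono')
    fix \<omega>
    have "(\<Sum>t\<in>{1..T}. Max (mu t ` {1..K}) - mu t (arm \<omega> t))
       = (\<Sum>i<N. \<Sum>t\<in>{Suc (i * \<tau>)..<b i}. Max (mu t ` {1..K}) - mu t (arm \<omega> t))"
      using sum_epochs[of "\<lambda>t. Max (mu t ` {1..K}) - mu t (arm \<omega> t)" N \<tau> T] unfolding NT b_def .
    also have "\<dots> \<le> (\<Sum>i<N. epoch_bound (v i) (i * \<tau>) (b i) \<omega>)"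
    proof (intro sum_mono epoch_regret_le[OF psi _ bi(1) v0])
      fix i s t k assume *: "s \<in> {Suc (i * \<tau>)..<b i}" "t \<in> {Suc (i * \<tau>)..<b i}" "k \<in> {1..K}"
      have "\<bar>mu s k - mu t k\<bar> \<le> (\<Sum>r\<in>{Suc (i * \<tau>)..<b i - 1}. D r)"
        by (rule abs_diff_le_variation) (use * in \<open>auto intro!: D simp: b_def\<close>)
      also have "\<dots> \<le> v i" unfolding v_def using D0 by (intro sum_mono2) auto
      finally show "\<bar>mu s k - mu t k\<bar> \<le> v i" .
    qed auto
    finally show "(\<Sum>t\<in>{1..T}. Max (mu t ` {1..K}) - mu t (arm \<omega> t)) \<le> (\<Sum>i<N. epoch_bound (v i) (i * \<tau>) (b i) \<omega>)" .
    show "0 \<le> (\<Sum>i<N. epoch_bound (v i) (i * \<tau>) (b i) \<omega>)"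
      using v0 by (intro sum_nonneg epoch_bound_nonneg)
  qed (use E(1) in auto)
  also have "\<dots> = (\<Sum>i<N. \<integral>\<omega>. epoch_bound (v i) (i * \<tau>) (b i) \<omega> \<partial>P)"
    using E(1) by (rule Bochner_Integration.integral_sum)
  also have "\<dots> \<le> (\<Sum>i<N. 2 * real \<tau> * v i + regret_const a \<zeta> * sqrt (real K * real \<tau>))"
    by (intro sum_mono E(2))
  also have "\<dots> = 2 * real \<tau> * (\<Sum>i<N. v i) + real N * (regret_const a \<zeta> * sqrt (real K * real \<tau>))"
    by (simp add: sum.distrib sum_distrib_left)
  also have "\<dots> \<le> 2 * real \<tau> * V + 2 * real T / real \<tau> * (regret_const a \<zeta> * sqrt (real K * real \<tau>))"
  proof (intro add_mono mult_left_mono mult_right_mono)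
    show "0 \<le> regret_const a \<zeta> * sqrt (real K * real \<tau>)" using a by (simp add: regret_const_def)
  qed (use sumv Nle in auto)
  also have "2 * real T / real \<tau> * (regret_const a \<zeta> * sqrt (real K * real \<tau>)) = 2 * regret_const a \<zeta> * (real T * sqrt (real K / real \<tau>))"
  proof -
    have "sqrt (real K * real \<tau>) / real \<tau> = sqrt (real K / real \<tau>)"
      using tau by (simp add: real_sqrt_mult real_sqrt_divide real_div_sqrt field_simps)
    moreover have "2 * real T / real \<tau> * (regret_const a \<zeta> * sqrt (real K * real \<tau>))
        = 2 * regret_const a \<zeta> * (real T * (sqrt (real K * real \<tau>) / real \<tau>))" by simp
    ultimately show ?thesis by (simp only:)
  qed
  finally show ?thesis .
qed

end

section \<open>Inserting the epoch length\<close>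

lemma regret_scale:
  fixes k t v :: real
  assumes "k > 0" "t > 0" "v > 0"
  defines "R \<equiv> (k * v) powr (1/3) * t powr (2/3)" and "x \<equiv> k powr (1/3) * (t / v) powr (2/3)"
  shows "R > 0" "R ^ 3 = k * v * t\<^sup>2" "x * v = R"
proof -
  show "R > 0" using assms by simp
  have c: "(y powr (1/3)) ^ 3 = y" "(y powr (2/3)) ^ 3 = y\<^sup>2" if "y > 0" for y :: real
    using that by (simp_all add: powr_power)
  show "R ^ 3 = k * v * t\<^sup>2" unfolding R_def power_mult_distrib using assms c by simp
  have "v = v powr (1/3) * v powr (2/3)" using assms by (simp add: powr_add[symmetric])
  hence "x * v = k powr (1/3) * (t / v) powr (2/3) * (v powr (1/3) * v powr (2/3))" by (simp add: x_def)
  also have "\<dots> = R" using assms by (simp add: R_def powr_mult powr_divide)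
  finally show "x * v = R" .
qed

lemma rr_regret_le_horizon:
  assumes "K \<ge> 1" and f: "env_class K T V f"
  shows "rr_regret a \<zeta> K T V f \<le> 2 * real T"
proof -
  have rd: "reward_dist (f t k)" if "t \<in> {1..T}" "k \<in> {1..K}" for t k
    using f that by (simp add: env_class_def reward_dist_def reward_dist_axioms_def)
  have m: "\<bar>mean f t k\<bar> \<le> 1" if "t \<in> {1..T}" "k \<in> {1..K}" for t k
    unfolding mean_def by (rule reward_dist.abs_mean_le_1[OF rd[OF that]])
  define P where "P = PiM ({1..T} \<times> {1..K}) (\<lambda>(t, k). f t k)"
  have "prob_space P" unfolding P_def
    by (rule prob_space_PiM) (use rd in \<open>auto simp: reward_dist_def\<close>)
  then interpret prob_space P .
  have "rr_regret a \<zeta> K T V f \<le> (\<integral>\<omega>. 2 * real T \<partial>P)"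
    unfolding rr_regret_def P_def[symmetric]
  proof (rule integral_mono')
    fix \<omega>
    have "Max (mean f t ` {1..K}) - mean f t (rr_arm a \<zeta> (rr_tau K T V) K \<omega> t) \<le> 2" if t: "t \<in> {1..T}" for t
    proof -
      have "Max (mean f t ` {1..K}) \<le> 1" using m[OF t] assms(1) by (subst Max_le_iff) (auto simp: abs_le_iff)
      moreover have "mean f t (rr_arm a \<zeta> (rr_tau K T V) K \<omega> t) \<ge> -1"
        using m[OF t rr_arm_range[OF assms(1)], of a \<zeta> "rr_tau K T V" \<omega> t] by (simp add: abs_le_iff)
      ultimately show ?thesis by linarith
    qed
    hence "(\<Sum>t\<in>{1..T}. Max (mean f t ` {1..K}) - mean f t (rr_arm a \<zeta> (rr_tau K T V) K \<omega> t)) \<le> (\<Sum>t\<in>{1..T}. 2)"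
      by (rule sum_mono)
    thus "(\<Sum>t\<in>{1..T}. Max (mean f t ` {1..K}) - mean f t (rr_arm a \<zeta> (rr_tau K T V) K \<omega> t)) \<le> 2 * real T"
      by simp
  qed auto
  thus ?thesis by (simp add: prob_space)
qed

lemma reward_dist_return: "reward_dist (return borel 0)"
  unfolding reward_dist_def reward_dist_axioms_def
  by (auto intro!: prob_space_return simp: nn_integral_return)

lemma rr_regret_le_epochs:
  assumes "a > 1" "\<zeta> > 0" "psi (2 * \<zeta> / a) \<ge> 2 * a / \<zeta>" "K \<ge> 1"
    and tau: "\<tau> = rr_tau K T V" "K \<le> \<tau>" "\<tau> \<le> T" and f: "env_class K T V f"
  shows "rr_regret a \<zeta> K T V f
    \<le> 2 * real \<tau> * V + 2 * regret_const a \<zeta> * (real T * sqrt (real K / real \<tau>))"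
proof -
  \<comment> \<open>The locale wants a reward distribution at every index; outside the index set of
    the product the point mass at 0 is used, which does not affect \<open>PiM\<close>.\<close>
  define M where "M i = (if i \<in> {1..T} \<times> {1..K} then f (fst i) (snd i) else return borel 0)" for i
  have rd: "reward_dist (M i)" for i
    using f reward_dist_return
    by (auto simp: M_def env_class_def reward_dist_def reward_dist_axioms_def)
  interpret rrmoss_env a \<zeta> \<tau> K M T
    using assms(1,2,4) tau(2) rd by (intro rrmoss_env.intro rrmoss.intro rrmoss_env_axioms.intro)
  have mean: "mean f t k = mu t k" if "t \<in> {1..T}" "k \<in> {1..K}" for t k
    using that by (simp add: mean_def mu_def M_def)
  have P: "PiM ({1..T} \<times> {1..K}) (\<lambda>(t, k). f t k) = P"
    by (rule PiM_cong) (auto simp: M_def)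
  have "rr_regret a \<zeta> K T V f = (\<integral>\<omega>. (\<Sum>t\<in>{1..T}. Max (mu t ` {1..K}) - mu t (arm \<omega> t)) \<partial>P)"
    unfolding rr_regret_def P tau(1)[symmetric] arm_def[symmetric]
  proof (intro Bochner_Integration.integral_cong refl sum.cong)
    fix \<omega> t assume t: "t \<in> {1..T}"
    have "mean f t ` {1..K} = mu t ` {1..K}" using mean[OF t] by (intro image_cong) auto
    thus "Max (mean f t ` {1..K}) - mean f t (arm \<omega> t) = Max (mu t ` {1..K}) - mu t (arm \<omega> t)"
      using mean[OF t arm_range] by simp
  qed
  also have "\<dots> \<le> 2 * real \<tau> * V + 2 * regret_const a \<zeta> * (real T * sqrt (real K / real \<tau>))"
  proof (rule expected_regret_le[OF assms(3) tau(3)])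
    have "(\<Sum>t\<in>{1..<T}. SUP k\<in>{1..K}. \<bar>mu (Suc t) k - mu t k\<bar>)
       = (\<Sum>t\<in>{1..<T}. SUP k\<in>{1..K}. \<bar>mean f (t + 1) k - mean f t k\<bar>)"
      by (intro sum.cong SUP_cong refl) (simp add: mean)
    thus "(\<Sum>t\<in>{1..<T}. SUP k\<in>{1..K}. \<bar>mu (Suc t) k - mu t k\<bar>) \<le> V"
      using f by (simp add: env_class_def)
  qed
  finally show ?thesis .
qed

text \<open>Supplies the nonemptiness that \<open>cSUP_least\<close> requires for a supremum of
  reals.\<close>

lemma env_class_return: "K \<ge> 1 \<Longrightarrow> V \<ge> 0 \<Longrightarrow> env_class K T V (\<lambda>t k. return borel 0)"
  using reward_dist_return
  by (auto simp: env_class_def mean_def reward_dist_def reward_dist_axioms_def)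

theorem theorem4:
  fixes a \<zeta> :: real
  assumes "a > 1" and "\<zeta> > 0" and "psi (2 * \<zeta> / a) \<ge> 2 * a / \<zeta>"
  shows "\<exists>C>0. \<forall>(K::nat) (T::nat) (V::real).
           K \<ge> 1 \<and> T \<ge> 1 \<and> V > 0 \<and> sqrt (real K / real T) \<le> V \<longrightarrow>
           (SUP f\<in>{f. env_class K T V f}. rr_regret a \<zeta> K T V f)
             \<le> C * (real K * V) powr (1/3) * real T powr (2/3)"
proof -
  define c where "c = regret_const a \<zeta>"
  \<comment> \<open>The 4 comes from \<open>2 * \<tau> * V\<close> with
    \<open>\<tau> \<le> 2 * x\<close> and \<open>x * V = R\<close>, the rest from the square root
    term; the absolute value avoids a sign argument. The case \<open>K * V \<ge> T\<close> needs
    only 2.\<close>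
  define C where "C = 4 + 2 * \<bar>c\<bar>"
  have "rr_regret a \<zeta> K T V f \<le> C * ((real K * V) powr (1/3) * real T powr (2/3))"
    if K: "K \<ge> 1" and T: "T \<ge> 1" and V: "V > 0" and KTV: "sqrt (real K / real T) \<le> V" and f: "env_class K T V f"
    for K T V f
  proof -
    define R where "R = (real K * V) powr (1/3) * real T powr (2/3)"
    define x where "x = real K powr (1/3) * (real T / V) powr (2/3)"
    have KT0: "real K > 0" "real T > 0" using K T by simp_all
    note R = regret_scale[OF KT0 V, folded R_def x_def]
    have x0: "x > 0" using KT0 V by (simp add: x_def)
    have x3: "x ^ 3 = real K * (real T)\<^sup>2 / V\<^sup>2"
    proof -
      have "x ^ 3 * V ^ 3 = real K * V * (real T)\<^sup>2" using R(2,3) by (simp add: power_mult_distrib[symmetric])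
      hence "V * (x ^ 3 * V\<^sup>2) = V * (real K * (real T)\<^sup>2)" by (simp add: power2_eq_square power3_eq_cube mult_ac)
      hence "x ^ 3 * V\<^sup>2 = real K * (real T)\<^sup>2" using V by simp
      thus ?thesis using V by (simp add: field_simps)
    qed
    show ?thesis
    proof (cases "real K * V \<ge> real T")
      case True
      have "real T ^ 3 = real T * (real T)\<^sup>2" by (simp add: power2_eq_square power3_eq_cube)
      also have "\<dots> \<le> R ^ 3" unfolding R(2) using True by (intro mult_right_mono) auto
      finally have "real T \<le> R" using R(1) by (simp add: power_mono_iff)
      hence "2 * real T \<le> C * R" unfolding C_def using KT0 R(1) by (intro mult_mono) auto
      thus ?thesis using rr_regret_le_horizon[OF K f, of a \<zeta>] unfolding R_def by linarith
    next
      case False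
      define \<tau> where "\<tau> = rr_tau K T V"
      have tau: "x \<le> real \<tau>" "real \<tau> \<le> x + 1"
        unfolding \<tau>_def rr_tau_def x_def[symmetric] using x0 by linarith+
      \<comment> \<open>Here \<open>K * V < T\<close> yields \<open>K \<le> x\<close>, hence
        \<open>K \<le> \<tau>\<close> and also \<open>x \<ge> 1\<close>.\<close>
      have "real K ^ 3 * V\<^sup>2 = real K * (real K * V)\<^sup>2" by (simp add: power2_eq_square power3_eq_cube)
      also have "\<dots> \<le> real K * (real T)\<^sup>2" using False V by (intro mult_left_mono power_mono) auto
      finally have "real K ^ 3 \<le> x ^ 3" unfolding x3 using V by (simp add: pos_le_divide_eq)
      hence Kx: "real K \<le> x" using x0 by (simp add: power_mono_iff)
      \<comment> \<open>The lower bound on \<open>V\<close> enters here: it gives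
        \<open>x \<le> T\<close> and so at least one full epoch.\<close>
      have "real K / real T \<le> V\<^sup>2" using KTV by (rule sqrt_le_D)
      hence "real K * (real T)\<^sup>2 \<le> V\<^sup>2 * real T ^ 3"
        using KT0 by (simp add: pos_divide_le_eq power2_eq_square power3_eq_cube mult_ac)
      hence "x ^ 3 \<le> real T ^ 3" unfolding x3 using V by (simp add: pos_divide_le_eq mult.commute)
      hence xT: "x \<le> real T" using x0 by (simp add: power_mono_iff)
      have "\<tau> \<le> T" unfolding \<tau>_def rr_tau_def x_def[symmetric] using xT by linarith
      moreover have "K \<le> \<tau>" using Kx tau by linarith
      ultimately have "rr_regret a \<zeta> K T V f \<le> 2 * real \<tau> * V + 2 * c * (real T * sqrt (real K / real \<tau>))"
        unfolding c_def using assms K f by (intro rr_regret_le_epochs) (auto simp: \<tau>_def)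
      also have "\<dots> \<le> 4 * R + 2 * \<bar>c\<bar> * R"
      proof (rule add_mono)
        have "x \<ge> 1" using Kx K by linarith
        hence "real \<tau> \<le> 2 * x" using tau by linarith
        hence "real \<tau> * V \<le> 2 * x * V" using V by (intro mult_right_mono) auto
        thus "2 * real \<tau> * V \<le> 4 * R" unfolding R(3)[symmetric] by (simp add: mult_ac)
        \<comment> \<open>The other half of the balance: at epoch length x both the drift cost
          \<open>x * V\<close> and the learning cost \<open>T * sqrt (K / x)\<close> equal
          \<open>R\<close>.\<close>
        have "(real T)\<^sup>2 * (real K / x) = R\<^sup>2"
        proof -
          have "R\<^sup>2 * x * V = R ^ 3" using R(3) by (simp add: power2_eq_square power3_eq_cube)
          hence "V * (R\<^sup>2 * x) = V * (real K * (real T)\<^sup>2)" unfolding R(2) by (simp add: mult_ac)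
          hence "R\<^sup>2 * x = real K * (real T)\<^sup>2" using V by simp
          thus ?thesis using x0 by (simp add: field_simps)
        qed
        hence "sqrt ((real T)\<^sup>2 * (real K / x)) = R" using R(1) by simp
        hence TR: "real T * sqrt (real K / x) = R" unfolding real_sqrt_mult by simp
        have "real T * sqrt (real K / real \<tau>) \<le> real T * sqrt (real K / x)"
          using tau x0 KT0 by (intro mult_left_mono real_sqrt_le_mono divide_left_mono) auto
        hence "real T * sqrt (real K / real \<tau>) \<le> R" unfolding TR .
        hence "2 * \<bar>c\<bar> * (real T * sqrt (real K / real \<tau>)) \<le> 2 * \<bar>c\<bar> * R" by (intro mult_left_mono) auto
        moreover have "2 * c * (real T * sqrt (real K / real \<tau>)) \<le> 2 * \<bar>c\<bar> * (real T * sqrt (real K / real \<tau>))"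
          by (intro mult_right_mono) auto
        ultimately show "2 * c * (real T * sqrt (real K / real \<tau>)) \<le> 2 * \<bar>c\<bar> * R" by linarith
      qed
      also have "\<dots> = C * R" by (simp add: C_def algebra_simps)
      finally show ?thesis unfolding R_def .
    qed
  qed
  hence "(SUP f\<in>{f. env_class K T V f}. rr_regret a \<zeta> K T V f) \<le> C * (real K * V) powr (1/3) * real T powr (2/3)"
    if "K \<ge> 1 \<and> T \<ge> 1 \<and> V > 0 \<and> sqrt (real K / real T) \<le> V" for K T V
    unfolding mult.assoc using that env_class_return[of K V T] by (intro cSUP_least) auto
  moreover have "C > 0" by (simp add: C_def)
  ultimately show ?thesis by blast
qed

end
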